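(* Let $G$ be a random graph whose nodes are labeled by the integers. For each node $x$ let $\Delta_x$ be a finite set of integer offsets chosen independently from some common distribution, subject to the constraint that $-1$ and $+1$ are present in every $\Delta_x$, and let node $x$ have an outgoing link to $x - \delta$ for each $\delta \in \Delta_x$. Let $\ell = \mathbb{E}[|\Delta|]$. Consider a greedy routing trajectory in $G$ starting at a point chosen uniformly from $\{1, \ldots, n\}$ and ending at $0$. With one-sided greedy routing, the expected time to reach $0$ is $\Omega\!\left(\frac{\log^2 n}{\ell \log\log n}\right)$. With two-sided greedy routing, the expected time to reach $0$ is $\Omega\!\left(\frac{\log^2 n}{\ell^2 \log\log n}\right)$, provided $\Delta$ is generated by including each integer $\delta$ in $\Delta$ with probability $p_\delta$, where (a) $p$ is unimodal (nonincreasing in $\delta$ for $\delta > 0$ and nondecreasing in $\delta$ for $\delta < 0$), (b) $p$ is symmetric about $0$ ($p_\delta = p_{-\delta}$), and (c) the events of including distinct $\delta, \delta'$ are pairwise independent.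
   Context: The time of a routing trajectory is its number of hops. One-sided greedy routing: when the message is at node $x$ with target $0$, it moves along the link of $x$ leading to the node $x - \delta$ ($\delta \in \Delta_x$) with the smallest non-negative label (it never passes the target). Two-sided greedy routing: it moves to a neighbor $x - \delta$ whose label has the smallest absolute value, ties broken arbitrarily. In the two-sided case $p_1 = p_{-1} = 1$ since $\pm 1$ are always present. *)

theory Defs
  imports "HOL-Probability.Probability"
begin

(* There are only countably many finite sets of integers, so every distribution on
   them is a probability mass function. *)
definition offset_distribution :: "int set pmf \<Rightarrow> bool" where
  "offset_distribution D \<longleftrightarrow> (\<forall>A \<in> set_pmf D. finite A \<and> -1 \<in> A \<and> 1 \<in> A)"

(* Extended value: the mean number of links is not assumed to be finite. *)
definition mean_links :: "int set pmf \<Rightarrow> ennreal" where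
  "mean_links D = (\<integral>\<^sup>+ A. of_nat (card A) \<partial>measure_pmf D)"

definition incl_prob :: "int set pmf \<Rightarrow> int \<Rightarrow> real" where
  "incl_prob D \<delta> = measure_pmf.prob D {A. \<delta> \<in> A}"

definition unimodal :: "(int \<Rightarrow> real) \<Rightarrow> bool" where
  "unimodal p \<longleftrightarrow>
     (\<forall>\<delta> \<delta>'. 0 < \<delta> \<and> \<delta> \<le> \<delta>' \<longrightarrow> p \<delta>' \<le> p \<delta>) \<and>
     (\<forall>\<delta> \<delta>'. \<delta> \<le> \<delta>' \<and> \<delta>' < 0 \<longrightarrow> p \<delta> \<le> p \<delta>')"

definition pairwise_indep_offsets :: "int set pmf \<Rightarrow> bool" where
  "pairwise_indep_offsets D \<longleftrightarrow>
     (\<forall>\<delta> \<delta>'. \<delta> \<noteq> \<delta>' \<longrightarrow> prob_space.indep_event (measure_pmf D) {A. \<delta> \<in> A} {A. \<delta>' \<in> A})"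

definition neighbors :: "int set \<Rightarrow> int \<Rightarrow> int set" where
  "neighbors A x = (\<lambda>\<delta>. x - \<delta>) ` A"

definition one_sided_step :: "int set \<Rightarrow> int \<Rightarrow> int \<Rightarrow> bool" where
  "one_sided_step A x y \<longleftrightarrow>
     y \<in> neighbors A x \<and> 0 \<le> y \<and> (\<forall>z \<in> neighbors A x. 0 \<le> z \<longrightarrow> y \<le> z)"

(* A relation rather than a function: y and -y may both qualify, and either is allowed. *)
definition two_sided_step :: "int set \<Rightarrow> int \<Rightarrow> int \<Rightarrow> bool" where
  "two_sided_step A x y \<longleftrightarrow>
     y \<in> neighbors A x \<and> (\<forall>z \<in> neighbors A x. \<bar>y\<bar> \<le> \<bar>z\<bar>)"

(* Only the part of X up to its first visit to the target 0 is constrained. *)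
definition trajectory ::
  "(int set \<Rightarrow> int \<Rightarrow> int \<Rightarrow> bool) \<Rightarrow> (int \<Rightarrow> int set) \<Rightarrow> int \<Rightarrow> (nat \<Rightarrow> int) \<Rightarrow> bool" where
  "trajectory step \<Delta> x X \<longleftrightarrow>
     X 0 = x \<and>
     (\<forall>t. (\<forall>s\<le>t. X s \<noteq> 0) \<longrightarrow> step (\<Delta> (X t)) (X t) (X (Suc t)))"

(* The number of hops before the first visit to 0; infinite if there is none. *)
definition hops :: "(nat \<Rightarrow> int) \<Rightarrow> ennreal" where
  "hops X = (INF t \<in> {t. X t = 0}. of_nat t)"

(* Independent offset sets, one per node, together with an independent uniform start. *)
definition routing_space :: "int set pmf \<Rightarrow> nat \<Rightarrow> ((int \<Rightarrow> int set) \<times> int) measure" where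
  "routing_space D n =
     (\<Pi>\<^sub>M x \<in> (UNIV :: int set). measure_pmf D) \<Otimes>\<^sub>M measure_pmf (pmf_of_set {1..int n})"

(* X maps a graph and a start to the trajectory taken there, which includes all choices
   made at ties; these may depend on the whole graph and on the start. *)
definition greedy_routing ::
  "(int set \<Rightarrow> int \<Rightarrow> int \<Rightarrow> bool) \<Rightarrow> int set pmf \<Rightarrow> nat \<Rightarrow>
    ((int \<Rightarrow> int set) \<Rightarrow> int \<Rightarrow> nat \<Rightarrow> int) \<Rightarrow> bool" where
  "greedy_routing step D n X \<longleftrightarrow>
     (AE (\<Delta>, x) in routing_space D n. trajectory step \<Delta> x (X \<Delta> x))"

definition expected_time ::
  "int set pmf \<Rightarrow> nat \<Rightarrow> ((int \<Rightarrow> int set) \<Rightarrow> int \<Rightarrow> nat \<Rightarrow> int) \<Rightarrow> ennreal" where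
  "expected_time D n X = (\<integral>\<^sup>+ (\<Delta>, x). hops (X \<Delta> x) \<partial>routing_space D n)"

end

theory Submission
  imports Defs "HOL-Real_Asymp.Real_Asymp"
begin

text \<open>Absolute values strictly decrease along a greedy walk, so no node is visited twice and the
  expected time \<open>\<tau> x\<close> from \<open>x\<close> equals one plus the mean of \<open>\<tau>\<close> at the next node, where the links of
  \<open>x\<close> are drawn afresh. In the sum of \<open>\<tau>\<close> over an interval \<open>I\<close> of length \<open>k\<close> all nodes may therefore
  use the same offset set. It cuts \<open>I\<close> into runs that are translated to intervals again, and up to a
  fraction \<open>1 / B\<close> of \<open>I\<close> only offsets between \<open>k / B\<close> and \<open>2 * k\<close> produce cuts. In the one-sided case
  the intervals \<open>{1..k}\<close> are closed under this operation; in the two-sided case one needs all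
  intervals without \<open>0\<close>, and cuts come from midpoints of pairs of offsets, which costs a
  second factor \<open>l\<close>.

  The sum of \<open>\<tau>\<close> over \<open>I\<close> is then at least \<open>k * \<phi> k\<close> for every potential \<open>\<phi>\<close> whose expected drop per
  step is at most one. With \<open>B\<close> a power of \<open>ln n\<close>, such a potential is obtained by giving \<open>j\<close> the weight
  \<open>1 / (j * speed j)\<close>, where \<open>speed j\<close> is the mean number of offsets within a factor of about \<open>B\<close>
  of \<open>j\<close>. The speeds sum to \<open>O(l * ln (ln n))\<close> with respect to \<open>1 / j\<close>, and the Cauchy-Schwarz
  inequality bounds \<open>\<phi> n\<close> from below.\<close>

subsection \<open>Expected hop counts\<close>

text \<open>Ties may be broken with knowledge of the whole graph, so a walk is followed only up to its first
  tie: there \<open>det_step\<close> jumps to the target, which can only shorten it. Malformed offset sets are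
  treated in the same way.\<close>

definition det_step :: "(int set \<Rightarrow> int \<Rightarrow> int \<Rightarrow> bool) \<Rightarrow> int set \<Rightarrow> int \<Rightarrow> int" where
  "det_step step A x =
     (if (\<exists>!y. step A x y) \<and> \<bar>THE y. step A x y\<bar> < \<bar>x\<bar> then THE y. step A x y else 0)"

lemma det_step_cases:
  assumes "step A x y"
  shows "det_step step A x = y \<or> det_step step A x = 0"
  using assms by (auto simp: det_step_def the1_equality)

lemma det_step_eqI:
  assumes "step A x y" "\<And>z. step A x z \<Longrightarrow> z = y" "\<bar>y\<bar> < \<bar>x\<bar>"
  shows "det_step step A x = y"
proof -
  have "\<exists>!y. step A x y"
    using assms(1,2) by blast
  moreover have "(THE y. step A x y) = y"
    using assms(1,2) by (rule the_equality)
  ultimately show ?thesis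
    using assms(3) by (simp add: det_step_def)
qed

lemma abs_det_step_less: "x \<noteq> 0 \<Longrightarrow> \<bar>det_step step A x\<bar> < \<bar>x\<bar>"
  by (simp add: det_step_def)

function hop_count :: "(int set \<Rightarrow> int \<Rightarrow> int \<Rightarrow> bool) \<Rightarrow> (int \<Rightarrow> int set) \<Rightarrow> int \<Rightarrow> nat" where
  "hop_count step \<Delta> x = (if x = 0 then 0 else Suc (hop_count step \<Delta> (det_step step (\<Delta> x) x)))"
  by auto
termination
  by (relation "Wellfounded.measure (\<lambda>(step, \<Delta>, x). nat \<bar>x\<bar>)") (auto simp: abs_det_step_less)

declare hop_count.simps [simp del]

lemma hop_count_0 [simp]: "hop_count step \<Delta> 0 = 0"
  by (simp add: hop_count.simps)

text \<open>Induction on \<open>t\<close>: at a nonzero node \<open>det_step\<close> either makes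
  the first hop of \<open>X\<close>, and the shifted trajectory takes over, or it jumps to 0 and the
  count stops at 1.\<close>

lemma hop_count_le_trajectory:
  assumes "trajectory step \<Delta> x X" "X t = 0"
  shows "hop_count step \<Delta> x \<le> t"
  using assms
proof (induction t arbitrary: x X)
  case 0
  then show ?case by (auto simp: trajectory_def)
next
  case (Suc t)
  show ?case
  proof (cases "x = 0")
    case False
    have X0: "X 0 = x" using Suc.prems by (simp add: trajectory_def)
    have st: "step (\<Delta> x) x (X 1)"
      using Suc.prems(1) False X0 unfolding trajectory_def
      by (metis One_nat_def le_zero_eq)
    have "trajectory step \<Delta> (X 1) (\<lambda>t. X (Suc t))"
      unfolding trajectory_def
    proof (intro conjI allI impI)
      fix t assume nz: "\<forall>s\<le>t. X (Suc s) \<noteq> 0"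
      have "\<forall>s\<le>Suc t. X s \<noteq> 0"
      proof (intro allI impI)
        fix s assume "s \<le> Suc t"
        then show "X s \<noteq> 0" using nz False X0 by (cases s) auto
      qed
      then show "step (\<Delta> (X (Suc t))) (X (Suc t)) (X (Suc (Suc t)))"
        using Suc.prems(1) by (simp add: trajectory_def)
    qed simp
    then have "hop_count step \<Delta> (X 1) \<le> t"
      using Suc.IH Suc.prems(2) by blast
    then show ?thesis
      using det_step_cases[of step "\<Delta> x" x "X 1"] st False by (auto simp: hop_count.simps[of step \<Delta> x])
  qed simp
qed

lemma hop_count_le_hops:
  "trajectory step \<Delta> x X \<Longrightarrow> of_nat (hop_count step \<Delta> x) \<le> hops X"
  unfolding hops_def by (intro INF_greatest) (auto dest: hop_count_le_trajectory)

text \<open>The walk from \<open>x\<close> reads only the links of the nodes it visits, and none of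
  them has larger absolute value than \<open>x\<close>.\<close>

lemma hop_count_cong:
  assumes "\<And>y. \<bar>y\<bar> \<le> \<bar>x\<bar> \<Longrightarrow> \<Delta> y = \<Delta>' y"
  shows "hop_count step \<Delta> x = hop_count step \<Delta>' x"
  using assms
proof (induction "nat \<bar>x\<bar>" arbitrary: x rule: less_induct)
  case less
  show ?case
  proof (cases "x = 0")
    case False
    let ?y = "det_step step (\<Delta> x) x"
    have y: "\<bar>?y\<bar> < \<bar>x\<bar>" using False by (rule abs_det_step_less)
    have "hop_count step \<Delta> ?y = hop_count step \<Delta>' ?y"
      using y less.prems by (intro less.hyps) auto
    then show ?thesis
      using less.prems[of x] False by (simp add: hop_count.simps[of step _ x])
  qed simp
qed

abbreviation links_space :: "int set pmf \<Rightarrow> (int \<Rightarrow> int set) measure" where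
  "links_space D \<equiv> (\<Pi>\<^sub>M x \<in> (UNIV :: int set). measure_pmf D)"

text \<open>Induction on the absolute value of \<open>x\<close>: the next node depends measurably on
  the graph and ranges over a countable set of nodes closer to 0, so the recursive call is a
  countable case distinction.\<close>

lemma measurable_hop_count:
  "(\<lambda>\<Delta>. hop_count step \<Delta> x) \<in> measurable (links_space D) (count_space UNIV)"
proof (induction "nat \<bar>x\<bar>" arbitrary: x rule: less_induct)
  case less
  show ?case
  proof (cases "x = 0")
    case False
    have g: "(\<lambda>\<Delta>. det_step step (\<Delta> x) x) \<in> measurable (links_space D) (count_space {y. \<bar>y\<bar> < \<bar>x\<bar>})"
    proof -
      have "(\<lambda>\<Delta>. \<Delta> x) \<in> measurable (links_space D) (measure_pmf D)"
        by (rule measurable_component_singleton) simp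
      moreover have "(\<lambda>A. det_step step A x) \<in> measurable (measure_pmf D) (count_space {y. \<bar>y\<bar> < \<bar>x\<bar>})"
        using abs_det_step_less[OF False] by auto
      ultimately show ?thesis by (rule measurable_compose)
    qed
    have "(\<lambda>\<Delta>. hop_count step \<Delta> (det_step step (\<Delta> x) x)) \<in> measurable (links_space D) (count_space UNIV)"
      by (rule measurable_compose_countable'[OF _ g]) (use less in auto)
    then have "(\<lambda>\<Delta>. Suc (hop_count step \<Delta> (det_step step (\<Delta> x) x))) \<in> measurable (links_space D) (count_space UNIV)"
      by (rule measurable_compose) simp
    then show ?thesis using False by (simp add: hop_count.simps[of step _ x])
  qed simp
qed

definition mean_hops :: "(int set \<Rightarrow> int \<Rightarrow> int \<Rightarrow> bool) \<Rightarrow> int set pmf \<Rightarrow> int \<Rightarrow> ennreal" where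
  "mean_hops step D x = (\<integral>\<^sup>+\<Delta>. of_nat (hop_count step \<Delta> x) \<partial>links_space D)"

lemma borel_measurable_hop_count:
  "(\<lambda>\<Delta>. of_nat (hop_count step \<Delta> x) :: ennreal) \<in> borel_measurable (links_space D)"
  by (rule measurable_compose[OF measurable_hop_count]) simp

text \<open>Redrawing the links of \<open>x\<close> does not affect the walk after it has left \<open>x\<close>, because absolute
  values strictly decrease along the walk.\<close>

lemma mean_hops_step:
  assumes "x \<noteq> 0"
  shows "mean_hops step D x = 1 + (\<integral>\<^sup>+A. mean_hops step D (det_step step A x) \<partial>measure_pmf D)"
proof -
  interpret L: prob_space "links_space D"
    by (intro prob_space_PiM) (rule prob_space_measure_pmf)
  \<comment> \<open>Overwriting coordinate \<open>x\<close> by an independent sample from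
    \<open>D\<close> preserves the product measure; this separates the links of \<open>x\<close>
    from the rest of the graph.\<close>
  have eq: "distr (measure_pmf D \<Otimes>\<^sub>M links_space D) (links_space D) (\<lambda>(A, \<Delta>). \<Delta>(x := A)) = links_space D"
    using distr_pair_PiM_eq_PiM[of "UNIV :: int set" "\<lambda>_. measure_pmf D" x]
    by (simp add: prob_space_measure_pmf)
  have upd: "(\<lambda>(A, \<Delta>). \<Delta>(x := A)) \<in> measurable (measure_pmf D \<Otimes>\<^sub>M links_space D) (links_space D)"
    unfolding case_prod_unfold
    using measurable_fun_upd[of "UNIV :: int set" UNIV x snd "measure_pmf D \<Otimes>\<^sub>M links_space D" "\<lambda>_. measure_pmf D" fst]
    by simp
  have "mean_hops step D x =
      (\<integral>\<^sup>+\<Delta>. of_nat (hop_count step \<Delta> x)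
        \<partial>distr (measure_pmf D \<Otimes>\<^sub>M links_space D) (links_space D) (\<lambda>(A, \<Delta>). \<Delta>(x := A)))"
    by (simp add: mean_hops_def eq)
  also have "\<dots> = (\<integral>\<^sup>+z. of_nat (hop_count step (case z of (A, \<Delta>) \<Rightarrow> \<Delta>(x := A)) x)
        \<partial>(measure_pmf D \<Otimes>\<^sub>M links_space D))"
    by (rule nn_integral_distr[OF upd]) (simp add: borel_measurable_hop_count)
  also have "\<dots> = (\<integral>\<^sup>+A. \<integral>\<^sup>+\<Delta>. of_nat (hop_count step (\<Delta>(x := A)) x) \<partial>links_space D \<partial>measure_pmf D)"
  proof (subst L.nn_integral_fst[symmetric])
    show "(\<lambda>z. of_nat (hop_count step (case z of (A, \<Delta>) \<Rightarrow> \<Delta>(x := A)) x) :: ennreal)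
        \<in> borel_measurable (measure_pmf D \<Otimes>\<^sub>M links_space D)"
      by (rule measurable_compose[OF upd borel_measurable_hop_count])
  qed simp
  also have "\<dots> = (\<integral>\<^sup>+A. 1 + mean_hops step D (det_step step A x) \<partial>measure_pmf D)"
  proof (rule nn_integral_cong)
    fix A :: "int set"
    have "hop_count step (\<Delta>(x := A)) x = Suc (hop_count step \<Delta> (det_step step A x))" for \<Delta>
    proof -
      have "hop_count step (\<Delta>(x := A)) (det_step step A x) = hop_count step \<Delta> (det_step step A x)"
        using abs_det_step_less[OF assms, of step A] by (intro hop_count_cong) auto
      then show ?thesis using assms by (simp add: hop_count.simps[of step _ x])
    qed
    then have "(\<integral>\<^sup>+\<Delta>. of_nat (hop_count step (\<Delta>(x := A)) x) \<partial>links_space D)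
        = (\<integral>\<^sup>+\<Delta>. 1 + of_nat (hop_count step \<Delta> (det_step step A x)) \<partial>links_space D)"
      by simp
    also have "\<dots> = (\<integral>\<^sup>+\<Delta>. 1 \<partial>links_space D) + mean_hops step D (det_step step A x)"
      unfolding mean_hops_def by (rule nn_integral_add) (rule borel_measurable_const borel_measurable_hop_count)+
    finally show "(\<integral>\<^sup>+\<Delta>. of_nat (hop_count step (\<Delta>(x := A)) x) \<partial>links_space D)
        = 1 + mean_hops step D (det_step step A x)"
      by (simp only: nn_integral_const L.emeasure_space_1 mult_1)
  qed
  also have "\<dots> = 1 + (\<integral>\<^sup>+A. mean_hops step D (det_step step A x) \<partial>measure_pmf D)"
    by (subst nn_integral_add) (simp_all add: measure_pmf.emeasure_space_1[of D, simplified])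
  finally show ?thesis .
qed

text \<open>Almost surely \<open>hop_count\<close> bounds the hops of \<open>X\<close> from below,
  however ties are broken. Exchanging the integrals over graph and start leaves a bound that no
  longer depends on \<open>X\<close>.\<close>

lemma expected_time_ge:
  assumes "greedy_routing step D n X" "n > 0"
  shows "(\<Sum>x\<in>{1..int n}. mean_hops step D x) / of_nat n \<le> expected_time D n X"
proof -
  interpret L: prob_space "links_space D"
    by (intro prob_space_PiM) (rule prob_space_measure_pmf)
  let ?U = "measure_pmf (pmf_of_set {1..int n})"
  interpret P: pair_prob_space "links_space D" ?U ..
  have m: "(\<lambda>(\<Delta>, x). of_nat (hop_count step \<Delta> x) :: ennreal) \<in> borel_measurable (links_space D \<Otimes>\<^sub>M ?U)"
    unfolding case_prod_unfold
  proof (rule measurable_compose_countable[where g = snd and f = "\<lambda>x z. of_nat (hop_count step (fst z) x)"])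
    show "(\<lambda>z. of_nat (hop_count step (fst z) x) :: ennreal) \<in> borel_measurable (links_space D \<Otimes>\<^sub>M ?U)" for x
      by (rule measurable_compose[OF measurable_fst borel_measurable_hop_count])
    show "snd \<in> measurable (links_space D \<Otimes>\<^sub>M ?U) (count_space UNIV)"
      by (rule measurable_compose[OF measurable_snd]) simp
  qed
  have "(\<Sum>x\<in>{1..int n}. mean_hops step D x) / of_nat n = (\<integral>\<^sup>+x. mean_hops step D x \<partial>?U)"
    using assms(2) by (subst nn_integral_pmf_of_set) auto
  also have "\<dots> = (\<integral>\<^sup>+ (\<Delta>, x). of_nat (hop_count step \<Delta> x) \<partial>(links_space D \<Otimes>\<^sub>M ?U))"
    unfolding mean_hops_def using P.nn_integral_snd[OF m] by simp
  also have "\<dots> \<le> expected_time D n X"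
    unfolding expected_time_def routing_space_def
    using assms(1) unfolding greedy_routing_def routing_space_def
    by (intro nn_integral_mono_AE) (auto elim!: eventually_mono intro: hop_count_le_hops)
  finally show ?thesis .
qed

subsection \<open>The potential method\<close>

text \<open>Induction on a bound for the absolute values in \<open>I\<close>. By linearity of
  expectation only the law of each node's links matters, so a single sample \<open>A\<close> serves
  all of \<open>I\<close>. Each piece is mapped injectively onto a member of \<open>\<F>\<close>
  with a smaller bound, and \<open>R A\<close> is the potential lost under \<open>A\<close>.\<close>

lemma sum_mean_hops_ge_potential:
  fixes \<phi> :: "nat \<Rightarrow> real"
  assumes fin: "\<And>I. I \<in> \<F> \<Longrightarrow> finite I" and nz: "\<And>I. I \<in> \<F> \<Longrightarrow> 0 \<notin> I"
    and drop: "\<And>I. I \<in> \<F> \<Longrightarrow> \<exists>R :: int set \<Rightarrow> ennreal.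
      (\<integral>\<^sup>+A. R A \<partial>measure_pmf D) \<le> of_nat (card I) \<and>
      (\<forall>A\<in>set_pmf D. \<exists>P. finite P \<and> disjoint P \<and> \<Union>P \<subseteq> I \<and>
         (\<forall>p\<in>P. inj_on (det_step step A) p \<and> det_step step A ` p \<in> \<F>) \<and>
         ennreal (card I * \<phi> (card I)) \<le> (\<Sum>p\<in>P. ennreal (card p * \<phi> (card p))) + R A)"
    and I: "I \<in> \<F>"
  shows "ennreal (card I * \<phi> (card I)) \<le> (\<Sum>x\<in>I. mean_hops step D x)"
proof -
  have "ennreal (card I * \<phi> (card I)) \<le> (\<Sum>x\<in>I. mean_hops step D x)"
    if "I \<in> \<F>" "\<forall>x\<in>I. \<bar>x\<bar> < int N" for I N
    using that
  proof (induction N arbitrary: I)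
    case 0
    then have "I = {}" by fastforce
    then show ?case by simp
  next
    case (Suc N)
    let ?g = "det_step step"
    obtain R :: "int set \<Rightarrow> ennreal" where R: "(\<integral>\<^sup>+A. R A \<partial>measure_pmf D) \<le> of_nat (card I)"
      and P: "\<And>A. A \<in> set_pmf D \<Longrightarrow> \<exists>P. finite P \<and> disjoint P \<and> \<Union>P \<subseteq> I \<and>
         (\<forall>p\<in>P. inj_on (?g A) p \<and> ?g A ` p \<in> \<F>) \<and>
         ennreal (card I * \<phi> (card I)) \<le> (\<Sum>p\<in>P. ennreal (card p * \<phi> (card p))) + R A"
      using drop[OF Suc.prems(1)] by blast
    have pointwise: "ennreal (card I * \<phi> (card I)) \<le> (\<Sum>x\<in>I. mean_hops step D (?g A x)) + R A"
      if A: "A \<in> set_pmf D" for A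
    proof -
      obtain P where fP: "finite P" and dP: "disjoint P" and sub: "\<Union>P \<subseteq> I"
        and img: "\<And>p. p \<in> P \<Longrightarrow> inj_on (?g A) p \<and> ?g A ` p \<in> \<F>"
        and le: "ennreal (card I * \<phi> (card I)) \<le> (\<Sum>p\<in>P. ennreal (card p * \<phi> (card p))) + R A"
        using P[OF A] by blast
      have fI: "finite I" using fin Suc.prems(1) .
      have part: "ennreal (card p * \<phi> (card p)) \<le> (\<Sum>x\<in>p. mean_hops step D (?g A x))" if p: "p \<in> P" for p
      proof -
        have "\<forall>y\<in>?g A ` p. \<bar>y\<bar> < int N"
        proof
          fix y assume "y \<in> ?g A ` p"
          then obtain x where x: "x \<in> p" "y = ?g A x" by blast
          then have "x \<in> I" using p sub by blast
          then have "x \<noteq> 0" "\<bar>x\<bar> < int (Suc N)" using nz Suc.prems by auto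
          then show "\<bar>y\<bar> < int N"
            using abs_det_step_less[of x step A] x(2) by linarith
        qed
        then have "ennreal (card (?g A ` p) * \<phi> (card (?g A ` p))) \<le> (\<Sum>y\<in>?g A ` p. mean_hops step D y)"
          using img[OF p] by (intro Suc.IH) auto
        then show ?thesis
          using img[OF p] by (simp add: card_image sum.reindex)
      qed
      have "(\<Sum>p\<in>P. ennreal (card p * \<phi> (card p))) \<le> (\<Sum>p\<in>P. \<Sum>x\<in>p. mean_hops step D (?g A x))"
        by (intro sum_mono part)
      also have "\<dots> = (\<Sum>x\<in>\<Union>P. mean_hops step D (?g A x))"
      proof (subst sum.Union_disjoint)
        show "\<forall>p\<in>P. finite p" using sub fI by (meson Union_upper finite_subset subset_trans)
        show "\<forall>p\<in>P. \<forall>p'\<in>P. p \<noteq> p' \<longrightarrow> p \<inter> p' = {}" using dP by (auto simp: disjoint_def)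
      qed simp
      also have "\<dots> \<le> (\<Sum>x\<in>I. mean_hops step D (?g A x))"
        by (intro sum_mono2 fI sub) simp
      finally show ?thesis
        using le by (meson add_right_mono order_trans)
    qed
    have "ennreal (card I * \<phi> (card I)) = (\<integral>\<^sup>+A. ennreal (card I * \<phi> (card I)) \<partial>measure_pmf D)"
      by (simp add: measure_pmf.emeasure_space_1[of D, simplified])
    also have "\<dots> \<le> (\<integral>\<^sup>+A. (\<Sum>x\<in>I. mean_hops step D (?g A x)) + R A \<partial>measure_pmf D)"
      by (intro nn_integral_mono_AE) (auto simp: AE_measure_pmf_iff pointwise)
    also have "\<dots> = (\<Sum>x\<in>I. \<integral>\<^sup>+A. mean_hops step D (?g A x) \<partial>measure_pmf D) + (\<integral>\<^sup>+A. R A \<partial>measure_pmf D)"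
      by (simp add: nn_integral_add nn_integral_sum)
    \<comment> \<open>The mean loss is paid for by the first hop of each of the
      \<open>card I\<close> nodes.\<close>
    also have "\<dots> \<le> (\<Sum>x\<in>I. \<integral>\<^sup>+A. mean_hops step D (?g A x) \<partial>measure_pmf D) + (\<Sum>x\<in>I. 1)"
      using R by (intro add_left_mono) simp
    also have "\<dots> = (\<Sum>x\<in>I. mean_hops step D x)"
      unfolding sum.distrib[symmetric]
    proof (intro sum.cong refl)
      fix x assume "x \<in> I"
      then have "x \<noteq> 0" using nz Suc.prems(1) by blast
      then show "(\<integral>\<^sup>+A. mean_hops step D (?g A x) \<partial>measure_pmf D) + 1 = mean_hops step D x"
        by (simp add: mean_hops_step add.commute)
    qed
    finally show ?case .
  qed
  moreover have "\<exists>N. \<forall>x\<in>I. \<bar>x\<bar> < int N"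
  proof (cases "I = {}")
    case False
    have "\<forall>x\<in>I. \<bar>x\<bar> < int (Suc (nat (Max (abs ` I))))"
    proof
      fix x assume "x \<in> I"
      then have "\<bar>x\<bar> \<le> Max (abs ` I)" using fin[OF I] by simp
      then show "\<bar>x\<bar> < int (Suc (nat (Max (abs ` I))))" by linarith
    qed
    then show ?thesis by blast
  qed simp
  ultimately show ?thesis using I by blast
qed

text \<open>Here \<open>r\<close> counts the cuts made by \<open>g\<close>, which leave at most
  \<open>r + 1\<close> runs. The points lost are the cut points and at most a fraction
  \<open>1 / B\<close> of \<open>I\<close>; multiplying through by \<open>B\<close> avoids
  rounding.\<close>

definition splits :: "nat \<Rightarrow> nat \<Rightarrow> (int \<Rightarrow> int) \<Rightarrow> int set set \<Rightarrow> int set \<Rightarrow> bool" where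
  "splits B r g \<F> I \<longleftrightarrow>
     (\<exists>P. finite P \<and> disjoint P \<and> \<Union>P \<subseteq> I \<and> (\<forall>p\<in>P. inj_on g p \<and> g ` p \<in> \<F>) \<and>
        card P \<le> r + 1 \<and> B * card (I - \<Union>P) \<le> card I + B * r)"

text \<open>\<open>window_mass k\<close> bounds the expected number of cuts of an interval of length \<open>k\<close> (only offsets
  between \<open>k / B\<close> and \<open>2 * k\<close> matter), and \<open>speed j\<close> dominates it for all \<open>k\<close> between \<open>j\<close>
  and \<open>B * j\<close>. The potential is the time needed to descend the logarithmic scale at that speed.\<close>

locale log_potential =
  fixes q :: "nat \<Rightarrow> real" and B :: nat and M \<epsilon> :: real
  assumes q_nonneg: "\<And>\<delta>. 0 \<le> q \<delta>" and B_pos: "0 < B" and M_nonneg: "0 \<le> M"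
    and \<epsilon>_pos: "0 < \<epsilon>" and \<epsilon>_B: "1 \<le> \<epsilon> * B"
begin

definition window_mass :: "nat \<Rightarrow> real" where
  "window_mass k = M * (\<Sum>\<delta> | k < B * \<delta> \<and> \<delta> \<le> 2 * k. q \<delta>)"

definition speed :: "nat \<Rightarrow> real" where
  "speed j = M * (\<Sum>\<delta> | j < B * \<delta> \<and> \<delta> \<le> 2 * B * j. q \<delta>) + \<epsilon>"

definition \<phi> :: "nat \<Rightarrow> real" where
  "\<phi> k = (\<Sum>j\<in>{B<..k}. 1 / (j * speed j)) / 4"

lemma window_mass_nonneg: "0 \<le> window_mass k"
  unfolding window_mass_def by (intro mult_nonneg_nonneg M_nonneg sum_nonneg q_nonneg)

lemma speed_ge: "\<epsilon> \<le> speed j"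
  unfolding speed_def by (simp add: M_nonneg q_nonneg sum_nonneg)

lemma speed_pos: "0 < speed j"
  using speed_ge \<epsilon>_pos by (rule less_le_trans[rotated])

lemma window_mass_le_speed:
  assumes "j \<le> k" "k \<le> B * j"
  shows "window_mass k + \<epsilon> \<le> speed j"
proof -
  have "(\<Sum>\<delta> | k < B * \<delta> \<and> \<delta> \<le> 2 * k. q \<delta>) \<le> (\<Sum>\<delta> | j < B * \<delta> \<and> \<delta> \<le> 2 * B * j. q \<delta>)"
    using assms by (intro sum_mono2 q_nonneg) auto
  then show ?thesis
    unfolding window_mass_def speed_def using M_nonneg by (simp add: mult_left_mono)
qed

lemma \<phi>_nonneg: "0 \<le> \<phi> k"
  unfolding \<phi>_def using speed_pos by (intro divide_nonneg_nonneg sum_nonneg) (auto simp: less_imp_le)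

lemma \<phi>_eq_0: "k \<le> B \<Longrightarrow> \<phi> k = 0"
  by (simp add: \<phi>_def)

text \<open>For \<open>j\<close> between \<open>m\<close> and \<open>k\<close>,
  \<open>speed j\<close> is at least \<open>window_mass k + \<epsilon>\<close> because
  \<open>k \<le> B * m\<close>. This bounds each of the at most \<open>k - m\<close> additional
  terms of \<open>\<phi> k\<close>.\<close>

lemma \<phi>_diff_le:
  assumes "m \<le> k" "k \<le> B * m"
  shows "m * (\<phi> k - \<phi> m) \<le> (real k - m) / (4 * (window_mass k + \<epsilon>))"
proof (cases "m = 0")
  case False
  let ?w = "window_mass k + \<epsilon>"
  have w: "0 < ?w" using window_mass_nonneg \<epsilon>_pos by (rule add_nonneg_pos)
  have "4 * (\<phi> k - \<phi> m) = (\<Sum>j\<in>{B<..k} - {B<..m}. 1 / (j * speed j))"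
    unfolding \<phi>_def using assms by (subst sum_diff) auto
  also have "\<dots> \<le> (\<Sum>j\<in>{B<..k} - {B<..m}. 1 / (m * ?w))"
  proof (intro sum_mono)
    fix j assume j: "j \<in> {B<..k} - {B<..m}"
    then have "m \<le> j" "j \<le> k" by auto
    moreover from this assms have "k \<le> B * j" by (meson le_trans mult_le_mono2)
    ultimately have "m * ?w \<le> j * speed j"
      using window_mass_le_speed w by (intro mult_mono) auto
    then show "1 / (j * speed j) \<le> 1 / (m * ?w)"
      using False w \<open>m \<le> j\<close> speed_pos[of j] by (intro divide_left_mono) (auto intro!: mult_pos_pos)
  qed
  also have "\<dots> \<le> (real k - m) * (1 / (m * ?w))"
  proof -
    have "card ({B<..k} - {B<..m}) \<le> card {m<..k}" by (intro card_mono) auto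
    then have "real (card ({B<..k} - {B<..m})) \<le> real k - m" using assms by simp
    then show ?thesis using w by (simp add: divide_right_mono)
  qed
  finally have "m * (4 * (\<phi> k - \<phi> m)) \<le> m * ((real k - m) * (1 / (m * ?w)))"
    by (intro mult_left_mono) auto
  also have "\<dots> = 4 * ((real k - m) / (4 * ?w))"
    using False by (simp only: times_divide_eq_right mult_1_right) (simp add: divide_divide_eq_left[symmetric] del: divide_divide_eq_left distrib_left_numeral)
  finally show ?thesis by linarith
qed (use assms in simp)

text \<open>The loss of potential is \<open>(real k - S) * \<phi> k\<close> for the lost points plus
  \<open>m p * (\<phi> k - \<phi> (m p))\<close> for each piece. Both are estimated by
  \<open>k\<close> times an affine function of the number \<open>r\<close> of cuts.\<close>

lemma \<phi>_split:
  assumes k: "B < k" and fin: "finite P" and sum_le: "(\<Sum>p\<in>P. m p) \<le> k"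
    and cardP: "card P \<le> r + 1" and junk: "B * (k - (\<Sum>p\<in>P. m p)) \<le> k + B * r"
  shows "k * \<phi> k \<le> (\<Sum>p\<in>P. m p * \<phi> (m p))
    + k * (\<phi> k * (2 + 2 * r) / B + (2 * r + 1 / B) / (4 * (window_mass k + \<epsilon>)))"
proof -
  define \<alpha> where "\<alpha> = 1 / (4 * (window_mass k + \<epsilon>))"
  define S where "S = (\<Sum>p\<in>P. m p)"
  have \<alpha>: "0 \<le> \<alpha>" using window_mass_nonneg[of k] \<epsilon>_pos by (simp add: \<alpha>_def)
  have B: "0 < real B" using B_pos by simp
  have "B * (k - S) \<le> k + B * r" using junk by (simp add: S_def)
  then have "real (B * (k - S)) \<le> real (k + B * r)" by (rule of_nat_mono)
  then have kS: "real k - S \<le> k / B + r"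
    using sum_le B by (simp add: S_def field_simps)
  \<comment> \<open>A piece of length at least \<open>k / B\<close> is covered by
    \<open>\<phi>_diff_le\<close>. A shorter one has so few points that a drop by all of
    \<open>\<phi> k\<close> costs at most \<open>k / B * \<phi> k\<close>.\<close>
  have each: "m p * (\<phi> k - \<phi> (m p)) \<le> \<alpha> * (real k - m p) + k / B * \<phi> k" if p: "p \<in> P" for p
  proof -
    have mk: "m p \<le> k" using member_le_sum[OF p, of m] fin sum_le by simp
    show ?thesis
    proof (cases "k \<le> B * m p")
      case True
      then show ?thesis
        using \<phi>_diff_le[OF mk True] \<phi>_nonneg[of k] B by (simp add: \<alpha>_def add_increasing2)
    next
      case False
      then have "real (B * m p) \<le> k" by linarith
      then have "m p \<le> k / B" using B by (simp add: field_simps)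
      then have "m p * (\<phi> k - \<phi> (m p)) \<le> k / B * \<phi> k"
        using \<phi>_nonneg[of "m p"] \<phi>_nonneg[of k]
        by (smt (verit) mult_left_mono mult_right_mono of_nat_0_le_iff)
      moreover have "0 \<le> \<alpha> * (real k - m p)" using \<alpha> mk by (intro mult_nonneg_nonneg) auto
      ultimately show ?thesis by linarith
    qed
  qed
  have "k * \<phi> k - (\<Sum>p\<in>P. m p * \<phi> (m p)) = (real k - S) * \<phi> k + (\<Sum>p\<in>P. m p * (\<phi> k - \<phi> (m p)))"
    by (simp add: S_def right_diff_distrib left_diff_distrib sum_subtractf sum_distrib_right)
  also have "\<dots> \<le> (k / B + r) * \<phi> k + (\<Sum>p\<in>P. \<alpha> * (real k - m p) + k / B * \<phi> k)"
    by (intro add_mono mult_right_mono kS \<phi>_nonneg sum_mono each)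
  also have "(\<Sum>p\<in>P. \<alpha> * (real k - m p) + k / B * \<phi> k) = \<alpha> * (real (card P) * k - real S) + card P * (k / B * \<phi> k)"
    by (simp add: S_def sum.distrib sum_distrib_left[symmetric] sum_subtractf)
  \<comment> \<open>Since \<open>B < k\<close>, a summand \<open>r\<close> is absorbed by
    \<open>r * (k / B)\<close> or by \<open>r * k\<close>; having at most \<open>r + 1\<close>
    pieces turns \<open>card P * k - S\<close> into \<open>r * k + (k - S)\<close>.\<close>
  also have "(k / B + r) * \<phi> k + (\<alpha> * (real (card P) * k - real S) + card P * (k / B * \<phi> k))
      \<le> (k / B + r * (k / B)) * \<phi> k + (\<alpha> * (k * (2 * r + 1 / B)) + (r + 1) * (k / B * \<phi> k))"
  proof (intro add_mono mult_right_mono mult_left_mono \<alpha> \<phi>_nonneg order_refl)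
    have kB: "1 \<le> k / B" using k B by simp
    show "real r \<le> r * (k / B)" using mult_left_mono[OF kB, of "real r"] by simp
    have "card P * k \<le> (r + 1) * k" using cardP by (intro mult_right_mono) auto
    then have "real (card P * k) \<le> real ((r + 1) * k)" by (rule of_nat_mono)
    then have "real (card P) * k - real S \<le> r * k + (k - real S)" by (simp add: algebra_simps)
    also have "\<dots> \<le> r * k + (k / B + r)" using kS by simp
    also have "\<dots> \<le> k * (2 * r + 1 / B)"
    proof -
      have "real r * 1 \<le> real r * k" using k by (intro mult_left_mono) auto
      then show ?thesis by (simp add: algebra_simps)
    qed
    finally show "real (card P) * k - real S \<le> k * (2 * r + 1 / B)" by simp
    show "real (card P) \<le> real (r + 1)" using cardP by linarith
  qed (use \<phi>_nonneg[of k] B in simp)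
  also have "\<dots> = k * (\<phi> k * (2 + 2 * r) / B + (2 * r + 1 / B) / (4 * (window_mass k + \<epsilon>)))"
    by (simp add: \<alpha>_def algebra_simps add_divide_distrib)
  finally show ?thesis by simp
qed

text \<open>The loss is affine in the number of cuts, so its mean is controlled by the mean number
  of cuts, at most \<open>window_mass\<close>. Per node it has two parts: \<open>small\<close>
  bounds the first and \<open>\<epsilon>_B\<close> the second by \<open>1 / 2\<close>.\<close>

theorem sum_mean_hops_ge_\<phi>:
  assumes fin: "\<And>I. I \<in> \<F> \<Longrightarrow> finite I" and nz: "\<And>I. I \<in> \<F> \<Longrightarrow> 0 \<notin> I"
    and card_le: "\<And>I. I \<in> \<F> \<Longrightarrow> card I \<le> n"
    and small: "\<And>k. k \<le> n \<Longrightarrow> \<phi> k * (1 + window_mass k) \<le> B / 4"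
    and split: "\<And>I. I \<in> \<F> \<Longrightarrow> B < card I \<Longrightarrow> \<exists>r :: int set \<Rightarrow> nat.
      (\<integral>\<^sup>+A. of_nat (r A) \<partial>measure_pmf D) \<le> ennreal (window_mass (card I)) \<and>
      (\<forall>A\<in>set_pmf D. splits B (r A) (det_step step A) \<F> I)"
    and I: "I \<in> \<F>"
  shows "ennreal (card I * \<phi> (card I)) \<le> (\<Sum>x\<in>I. mean_hops step D x)"
proof (rule sum_mean_hops_ge_potential[OF fin nz _ I])
  fix I assume I: "I \<in> \<F>"
  define k where "k = card I"
  show "\<exists>R :: int set \<Rightarrow> ennreal. (\<integral>\<^sup>+A. R A \<partial>measure_pmf D) \<le> of_nat (card I) \<and>
      (\<forall>A\<in>set_pmf D. \<exists>P. finite P \<and> disjoint P \<and> \<Union>P \<subseteq> I \<and>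
         (\<forall>p\<in>P. inj_on (det_step step A) p \<and> det_step step A ` p \<in> \<F>) \<and>
         ennreal (card I * \<phi> (card I)) \<le> (\<Sum>p\<in>P. ennreal (card p * \<phi> (card p))) + R A)"
  proof (cases "B < k")
    \<comment> \<open>Short intervals have potential 0, so the empty family of pieces and zero loss
      suffice.\<close>
    case False
    then show ?thesis
      by (intro exI[of _ "\<lambda>_. 0"]) (auto simp: \<phi>_eq_0 k_def intro!: exI[of _ "{}"])
  next
    case True
    obtain r :: "int set \<Rightarrow> nat" where r: "(\<integral>\<^sup>+A. of_nat (r A) \<partial>measure_pmf D) \<le> ennreal (window_mass k)"
      and sp: "\<And>A. A \<in> set_pmf D \<Longrightarrow> splits B (r A) (det_step step A) \<F> I"
      using split[OF I] True by (auto simp: k_def)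
    let ?w = "window_mass k"
    have w: "0 \<le> ?w" "0 < ?w + \<epsilon>" using window_mass_nonneg[of k] \<epsilon>_pos by auto
    have B: "0 < real B" using B_pos by simp
    \<comment> \<open>The loss bound of \<open>\<phi>_split\<close> in the form
      \<open>a + b * r\<close>; with both coefficients nonnegative it can be integrated termwise as
      an extended real.\<close>
    define a where "a = k * (2 * \<phi> k / B + 1 / B / (4 * (?w + \<epsilon>)))"
    define b where "b = k * (2 * \<phi> k / B + 2 / (4 * (?w + \<epsilon>)))"
    have ab: "0 \<le> a" "0 \<le> b" using w \<phi>_nonneg[of k] B by (auto simp: a_def b_def)
    have R_eq: "k * (\<phi> k * (2 + 2 * s) / B + (2 * s + 1 / B) / (4 * (?w + \<epsilon>))) = a + b * s" for s :: real
      using w B by (simp add: a_def b_def divide_simps) (simp add: algebra_simps)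
    have kn: "k \<le> n" using card_le[OF I] by (simp add: k_def)
    have int: "(\<integral>\<^sup>+A. ennreal (a + b * r A) \<partial>measure_pmf D) \<le> of_nat k"
    proof -
      have "(\<integral>\<^sup>+A. ennreal (a + b * r A) \<partial>measure_pmf D)
          = (\<integral>\<^sup>+A. ennreal a + ennreal b * of_nat (r A) \<partial>measure_pmf D)"
        using ab by (simp add: ennreal_mult ennreal_of_nat_eq_real_of_nat)
      also have "\<dots> = ennreal a + ennreal b * (\<integral>\<^sup>+A. of_nat (r A) \<partial>measure_pmf D)"
        by (simp add: nn_integral_add nn_integral_cmult measure_pmf.emeasure_space_1[of D, simplified])
      also have "\<dots> \<le> ennreal a + ennreal b * ennreal ?w"
        by (intro add_left_mono mult_left_mono r) simp
      also have "\<dots> = ennreal (a + b * ?w)"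
        using ab w by (simp add: ennreal_mult)
      also have "\<dots> \<le> ennreal k"
      proof (rule ennreal_leI)
        have "\<phi> k * (2 + 2 * ?w) / B \<le> 1 / 2"
          using small[OF kn] B by (simp add: field_simps)
        moreover have "1 / B \<le> \<epsilon>" using \<epsilon>_B B by (simp add: field_simps)
        then have "(2 * ?w + 1 / B) / (4 * (?w + \<epsilon>)) \<le> 1 / 2"
          using w \<epsilon>_pos by (simp add: field_simps)
        ultimately have "\<phi> k * (2 + 2 * ?w) / B + (2 * ?w + 1 / B) / (4 * (?w + \<epsilon>)) \<le> 1"
          by linarith
        then show "a + b * ?w \<le> k"
          unfolding R_eq[symmetric] by (intro mult_left_le) auto
      qed
      finally show ?thesis by (simp add: ennreal_of_nat_eq_real_of_nat)
    qed
    have "\<exists>P. finite P \<and> disjoint P \<and> \<Union>P \<subseteq> I \<and>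
         (\<forall>p\<in>P. inj_on (det_step step A) p \<and> det_step step A ` p \<in> \<F>) \<and>
         ennreal (k * \<phi> k) \<le> (\<Sum>p\<in>P. ennreal (card p * \<phi> (card p))) + ennreal (a + b * r A)"
      if A: "A \<in> set_pmf D" for A
    proof -
      obtain P where P: "finite P" "disjoint P" "\<Union>P \<subseteq> I"
        "\<forall>p\<in>P. inj_on (det_step step A) p \<and> det_step step A ` p \<in> \<F>"
        "card P \<le> r A + 1" "B * card (I - \<Union>P) \<le> card I + B * r A"
        using sp[OF A] unfolding splits_def by blast
      have fU: "finite (\<Union>P)" using P(3) fin[OF I] by (rule finite_subset)
      have sum_card: "(\<Sum>p\<in>P. card p) = card (\<Union>P)"
        using P(2) fU by (subst card_Union_disjoint) (auto simp: finite_UnionD disjoint_def pairwise_def disjnt_def intro: finite_subset)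
      have le: "card (\<Union>P) \<le> k" unfolding k_def using P(3) fin[OF I] by (intro card_mono)
      have "card (I - \<Union>P) = k - card (\<Union>P)"
        unfolding k_def using P(3) fU by (intro card_Diff_subset)
      then have "B * (k - card (\<Union>P)) \<le> k + B * r A"
        using P(6) by (simp add: k_def)
      then have "k * \<phi> k \<le> (\<Sum>p\<in>P. card p * \<phi> (card p)) + (a + b * r A)"
        using \<phi>_split[where m = card, OF True P(1) _ P(5)] le unfolding R_eq sum_card by blast
      then have "ennreal (k * \<phi> k) \<le> ennreal ((\<Sum>p\<in>P. card p * \<phi> (card p)) + (a + b * r A))"
        by (rule ennreal_leI)
      also have "\<dots> = ennreal (\<Sum>p\<in>P. card p * \<phi> (card p)) + ennreal (a + b * r A)"
        using ab \<phi>_nonneg by (intro ennreal_plus) (auto intro!: sum_nonneg)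
      also have "ennreal (\<Sum>p\<in>P. card p * \<phi> (card p)) = (\<Sum>p\<in>P. ennreal (card p * \<phi> (card p)))"
        using \<phi>_nonneg by (intro sum_ennreal[symmetric]) auto
      finally show ?thesis using P by blast
    qed
    then show ?thesis
      using int unfolding k_def[symmetric] by (intro exI[of _ "\<lambda>A. ennreal (a + b * r A)"]) blast
  qed
qed

end

subsection \<open>The size of the potential\<close>

lemma ln_diff_le_sum_inverse:
  assumes "a \<le> b"
  shows "ln (real b + 1) - ln (real a + 1) \<le> (\<Sum>j\<in>{a<..b}. 1 / real j)"
  using assms
proof (induction b rule: dec_induct)
  case (step b)
  have "{a<..Suc b} = insert (Suc b) {a<..b}" using step.hyps by auto
  then show ?case
    using step.IH ln_diff_le_inverse[of "real b + 1"] by (simp add: add_ac)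
qed simp

lemma sum_inverse_le_ln_diff:
  assumes "0 < a" "a \<le> b"
  shows "(\<Sum>j\<in>{a..b}. 1 / real j) \<le> 1 + (ln b - ln a)"
  using assms(2)
proof (induction b rule: dec_induct)
  case base
  then show ?case using assms(1) by simp
next
  case (step b)
  have b: "0 < b" using step.hyps assms(1) by simp
  have "ln (b / real (Suc b)) \<le> b / real (Suc b) - 1" by (rule ln_le_minus_one) (use b in simp)
  then have "1 / real (Suc b) \<le> ln (Suc b) - ln b"
    using b by (simp add: ln_div field_simps)
  then show ?case using step by (simp add: atLeastAtMostSuc_conv)
qed

text \<open>Enlarging \<open>J\<close> to all integers between its least and greatest element keeps
  the ratio of the ends at most \<open>c\<close>.\<close>

lemma sum_inverse_le_ln_ratio:
  assumes "finite J" "0 \<notin> J" "0 \<le> ln c" "\<And>i j. i \<in> J \<Longrightarrow> j \<in> J \<Longrightarrow> real j \<le> c * real i" "0 < c"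
  shows "(\<Sum>j\<in>J. 1 / real j) \<le> 1 + ln c"
proof (cases "J = {}")
  case False
  define a b where "a = Min J" and "b = Max J"
  have ab: "a \<in> J" "b \<in> J" using False assms(1) by (auto simp: a_def b_def)
  have a: "0 < a" using ab assms(2) by (cases a) auto
  have le: "a \<le> b" using assms(1) ab by (simp add: a_def)
  have "(\<Sum>j\<in>J. 1 / real j) \<le> (\<Sum>j\<in>{a..b}. 1 / real j)"
    using assms(1) by (intro sum_mono2) (auto simp: a_def b_def)
  also have "\<dots> \<le> 1 + (ln b - ln a)"
    using a le by (rule sum_inverse_le_ln_diff)
  also have "ln b \<le> ln (c * a)"
    using assms(4)[OF ab] a le by (intro ln_mono) auto
  also have "\<dots> = ln c + ln a"
    using a assms(5) by (simp add: ln_mult)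
  finally show ?thesis by simp
qed (use assms in simp)

lemma harmonic_le: "0 < n \<Longrightarrow> (\<Sum>j\<in>{B<..n}. 1 / real j) \<le> 1 + ln n"
proof -
  assume n: "0 < n"
  have "(\<Sum>j\<in>{B<..n}. 1 / real j) \<le> (\<Sum>j\<in>{1..n}. 1 / real j)"
    by (intro sum_mono2) auto
  also have "\<dots> \<le> 1 + ln n" using sum_inverse_le_ln_diff[of 1 n] n by simp
  finally show ?thesis .
qed

context log_potential
begin

lemma window_mass_le:
  assumes "\<And>N. (\<Sum>\<delta>\<in>{1..N}. q \<delta>) \<le> l"
  shows "window_mass k \<le> M * l"
proof -
  have "(\<Sum>\<delta> | k < B * \<delta> \<and> \<delta> \<le> 2 * k. q \<delta>) \<le> (\<Sum>\<delta>\<in>{1..2 * k}. q \<delta>)"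
  proof (intro sum_mono2 q_nonneg)
    show "{\<delta>. k < B * \<delta> \<and> \<delta> \<le> 2 * k} \<subseteq> {1..2 * k}"
      by (auto simp: Suc_le_eq intro!: Nat.gr0I)
  qed simp
  also note assms
  finally show ?thesis
    unfolding window_mass_def using M_nonneg by (rule mult_left_mono)
qed

lemma \<phi>_le:
  fixes n :: nat
  assumes "0 < n" "k \<le> n"
  shows "\<phi> k \<le> (1 + ln n) / (4 * \<epsilon>)"
proof -
  have "(\<Sum>j\<in>{B<..k}. 1 / (j * speed j)) \<le> (\<Sum>j\<in>{B<..n}. 1 / j * (1 / \<epsilon>))"
  proof (rule order_trans[OF sum_mono sum_mono2])
    fix j assume "j \<in> {B<..k}"
    then have "0 < j" by auto
    then show "1 / (j * speed j) \<le> 1 / j * (1 / \<epsilon>)"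
      using speed_ge[of j] speed_pos[of j] \<epsilon>_pos by (simp add: field_simps)
  qed (use assms \<epsilon>_pos in auto)
  also have "\<dots> = (\<Sum>j\<in>{B<..n}. 1 / j) * (1 / \<epsilon>)" by (rule sum_distrib_right[symmetric])
  also have "\<dots> \<le> (1 + ln n) * (1 / \<epsilon>)"
    using harmonic_le[OF assms(1)] \<epsilon>_pos by (intro mult_right_mono) auto
  finally have "\<phi> k \<le> (1 + ln n) * (1 / \<epsilon>) / 4"
    unfolding \<phi>_def by (rule divide_right_mono) simp
  then show ?thesis by (simp add: mult.commute)
qed

text \<open>Each offset is counted in \<open>speed j\<close> only for \<open>j\<close> within a factor \<open>2 * B\<^sup>2\<close>, so the total
  speed over the scale is at most \<open>M * l\<close> times the logarithm of that factor.\<close>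

lemma sum_speed_le:
  assumes q: "\<And>N. (\<Sum>\<delta>\<in>{1..N}. q \<delta>) \<le> l" and n: "0 < n"
  shows "(\<Sum>j\<in>{B<..n}. speed j / j) \<le> \<epsilon> * (1 + ln n) + M * l * (1 + ln (2 * (real B)\<^sup>2))"
proof -
  let ?J = "{B<..n}" and ?E = "{1..2 * B * n}" and ?R = "\<lambda>j \<delta>. j < B * \<delta> \<and> \<delta> \<le> 2 * B * j"
  let ?c = "1 + ln (2 * (real B)\<^sup>2)"
  have B: "1 \<le> B" using B_pos by simp
  then have B2: "1 \<le> (real B)\<^sup>2" by simp
  \<comment> \<open>For \<open>j \<le> n\<close> all offsets counted at scale \<open>j\<close> lie
    in one finite range \<open>?E\<close>, so the two sums can be exchanged.\<close>
  have speed: "speed j / j = \<epsilon> * (1 / j) + M * (\<Sum>\<delta> | \<delta> \<in> ?E \<and> ?R j \<delta>. q \<delta> * (1 / j))" if "j \<in> ?J" for j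
  proof -
    have "{\<delta>. ?R j \<delta>} = {\<delta>. \<delta> \<in> ?E \<and> ?R j \<delta>}"
      using that by (auto simp: Suc_le_eq intro!: Nat.gr0I) (meson le_trans mult_le_mono2)
    then show ?thesis
      by (simp add: speed_def add_divide_distrib sum_divide_distrib[symmetric])
  qed
  have "(\<Sum>j\<in>?J. speed j / j) = (\<Sum>j\<in>?J. \<epsilon> * (1 / j)) + M * (\<Sum>j\<in>?J. \<Sum>\<delta> | \<delta> \<in> ?E \<and> ?R j \<delta>. q \<delta> * (1 / j))"
    using speed by (simp add: sum.distrib sum_distrib_left)
  also have "(\<Sum>j\<in>?J. \<Sum>\<delta> | \<delta> \<in> ?E \<and> ?R j \<delta>. q \<delta> * (1 / j))
      = (\<Sum>\<delta>\<in>?E. \<Sum>j | j \<in> ?J \<and> ?R j \<delta>. q \<delta> * (1 / j))"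
    by (rule sum.swap_restrict) auto
  also have "\<dots> \<le> (\<Sum>\<delta>\<in>?E. q \<delta> * ?c)"
  proof (intro sum_mono)
    fix \<delta> assume "\<delta> \<in> ?E"
    have "(\<Sum>j | j \<in> ?J \<and> ?R j \<delta>. 1 / real j) \<le> ?c"
    proof (rule sum_inverse_le_ln_ratio)
      show "0 \<le> ln (2 * (real B)\<^sup>2)" using B2 by (intro ln_ge_zero) linarith
      fix i j assume "i \<in> {j. j \<in> ?J \<and> ?R j \<delta>}" "j \<in> {j. j \<in> ?J \<and> ?R j \<delta>}"
      then have "j \<le> B * \<delta>" "B * \<delta> \<le> B * (2 * B * i)" by auto
      then have "j \<le> B * (2 * B * i)" by (rule le_trans)
      then have "real j \<le> real (B * (2 * B * i))" by (rule of_nat_mono)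
      then show "real j \<le> 2 * (real B)\<^sup>2 * real i" by (simp add: power2_eq_square mult_ac)
    qed (use B in auto)
    then show "(\<Sum>j | j \<in> ?J \<and> ?R j \<delta>. q \<delta> * (1 / j)) \<le> q \<delta> * ?c"
      unfolding sum_distrib_left[symmetric] by (intro mult_left_mono q_nonneg)
  qed
  also have "\<dots> \<le> l * ?c"
    unfolding sum_distrib_right[symmetric]
    using B2 by (intro mult_right_mono q) (auto intro!: add_nonneg_nonneg ln_ge_zero)
  also have "(\<Sum>j\<in>?J. \<epsilon> * (1 / j)) \<le> \<epsilon> * (1 + ln n)"
    unfolding sum_distrib_left[symmetric] using \<epsilon>_pos harmonic_le[OF n] by (intro mult_left_mono) auto
  finally show ?thesis
    using M_nonneg by (simp add: mult_left_mono mult.assoc)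
qed

text \<open>Cauchy-Schwarz with \<open>1 / j\<close> factored into the square roots of
  \<open>1 / (j * speed j)\<close> and \<open>speed j / j\<close>: a small total speed forces a
  large potential.\<close>

lemma \<phi>_ge:
  assumes q: "\<And>N. (\<Sum>\<delta>\<in>{1..N}. q \<delta>) \<le> l" and n: "B < n"
  shows "(ln (real n + 1) - ln (real B + 1))\<^sup>2
    \<le> 4 * \<phi> n * (\<epsilon> * (1 + ln n) + M * l * (1 + ln (2 * (real B)\<^sup>2)))"
proof -
  let ?J = "{B<..n}"
  have "(ln (real n + 1) - ln (real B + 1))\<^sup>2 \<le> (\<Sum>j\<in>?J. 1 / real j)\<^sup>2"
    using n ln_diff_le_sum_inverse[of B n] by (intro power_mono) auto
  also have "(\<Sum>j\<in>?J. 1 / real j) = (\<Sum>j\<in>?J. sqrt (1 / (j * speed j)) * sqrt (speed j / j))"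
  proof (intro sum.cong refl)
    fix j assume "j \<in> ?J"
    then have "0 < j" by auto
    then have "1 / (j * speed j) * (speed j / j) = (1 / real j)\<^sup>2"
      using speed_pos[of j] by (simp add: power2_eq_square)
    then show "1 / real j = sqrt (1 / (j * speed j)) * sqrt (speed j / j)"
      by (simp add: real_sqrt_mult[symmetric] del: times_divide_eq_right times_divide_eq_left)
  qed
  also have "\<dots>\<^sup>2 \<le> (\<Sum>j\<in>?J. (sqrt (1 / (j * speed j)))\<^sup>2) * (\<Sum>j\<in>?J. (sqrt (speed j / j))\<^sup>2)"
    by (rule Cauchy_Schwarz_ineq_sum)
  also have "\<dots> = 4 * \<phi> n * (\<Sum>j\<in>?J. speed j / j)"
  proof -
    have "(sqrt (1 / (j * speed j)))\<^sup>2 = 1 / (j * speed j)" "(sqrt (speed j / j))\<^sup>2 = speed j / j" for j :: nat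
      using speed_pos[of j] by simp_all
    then show ?thesis by (simp add: \<phi>_def)
  qed
  also have "\<dots> \<le> 4 * \<phi> n * (\<epsilon> * (1 + ln n) + M * l * (1 + ln (2 * (real B)\<^sup>2)))"
    using n \<phi>_nonneg by (intro mult_left_mono sum_speed_le q) auto
  finally show ?thesis .
qed

end

section \<open>Choice of \<open>B\<close> and the lower bound at scale \<open>n\<close>\<close>

definition threshold :: "nat \<Rightarrow> nat" where
  "threshold n = nat \<lceil>10 * ln (real n) ^ 4\<rceil>"

text \<open>With \<open>L = ln n\<close> and \<open>B\<close> about \<open>10 * L ^ 4\<close>, the
  term \<open>ln (2 * B ^ 2)\<close> grows like \<open>8 * ln L\<close>, while the difference of
  logarithms grows like \<open>L\<close>. After division by 12 the left side of the last inequality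
  is asymptotically \<open>2 / 3\<close> of the right side.\<close>

lemma eventually_threshold:
  "\<forall>\<^sub>F n in sequentially. 1 \<le> ln (ln (real n)) \<and> 1 \<le> ln (real n) \<and> threshold n < n \<and>
     (ln (real n))\<^sup>2 * (3 + ln (2 * (real (threshold n))\<^sup>2)) / 12
       \<le> ln (ln (real n)) * (ln (real n + 1) - ln (real (threshold n) + 1))\<^sup>2"
proof -
  \<comment> \<open>The ceiling is replaced by its upper bound \<open>10 * L ^ 4 + 1\<close>, which
    leaves asymptotic comparisons in the real variable \<open>L\<close>.\<close>
  have "\<forall>\<^sub>F L :: real in at_top. 1 \<le> ln L \<and> 1 \<le> L \<and> 10 * L ^ 4 + 1 < exp L \<and> 0 \<le> L - ln (10 * L ^ 4 + 2) \<and>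
      L\<^sup>2 * (3 + ln (2 * (10 * L ^ 4 + 1)\<^sup>2)) / 12 \<le> ln L * (L - ln (10 * L ^ 4 + 2))\<^sup>2"
    by (intro eventually_conj; real_asymp)
  moreover have "filterlim (\<lambda>n. ln (real n)) at_top sequentially" by real_asymp
  ultimately have "\<forall>\<^sub>F n in sequentially. let L = ln (real n) in
      1 \<le> ln L \<and> 1 \<le> L \<and> 10 * L ^ 4 + 1 < exp L \<and> 0 \<le> L - ln (10 * L ^ 4 + 2) \<and>
      L\<^sup>2 * (3 + ln (2 * (10 * L ^ 4 + 1)\<^sup>2)) / 12 \<le> ln L * (L - ln (10 * L ^ 4 + 2))\<^sup>2"
    unfolding Let_def by (rule eventually_compose_filterlim)
  then show ?thesis
    using eventually_gt_at_top[of 0]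
  proof eventually_elim
    case (elim n)
    define L where "L = ln (real n)"
    let ?B = "real (threshold n)"
    have L: "1 \<le> ln L" "1 \<le> L" "10 * L ^ 4 + 1 < exp L" "0 \<le> L - ln (10 * L ^ 4 + 2)"
      "L\<^sup>2 * (3 + ln (2 * (10 * L ^ 4 + 1)\<^sup>2)) / 12 \<le> ln L * (L - ln (10 * L ^ 4 + 2))\<^sup>2"
      using elim by (simp_all add: L_def Let_def)
    have ex: "exp L = n" using elim by (simp add: L_def)
    have L4: "1 \<le> L ^ 4" using L(2) by simp
    then have B: "?B \<le> 10 * L ^ 4 + 1" "10 * L ^ 4 \<le> ?B"
      by (auto simp: threshold_def L_def[symmetric])
    have "L\<^sup>2 * (3 + ln (2 * ?B\<^sup>2)) / 12 \<le> L\<^sup>2 * (3 + ln (2 * (10 * L ^ 4 + 1)\<^sup>2)) / 12"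
      using B L4 by (intro divide_right_mono mult_left_mono add_left_mono ln_mono power_mono) auto
    also note L(5)
    also have "ln L * (L - ln (10 * L ^ 4 + 2))\<^sup>2 \<le> ln L * (ln (real n + 1) - ln (?B + 1))\<^sup>2"
    proof (intro mult_left_mono power_mono diff_mono)
      show "L \<le> ln (real n + 1)" unfolding L_def using elim by (intro ln_mono) auto
      show "ln (?B + 1) \<le> ln (10 * L ^ 4 + 2)" using B by (intro ln_mono) auto
    qed (use L in auto)
    finally show ?case
      using L B ex by (simp add: L_def)
  qed
qed

text \<open>Common to both kinds of routing: \<open>M\<close> relates the mean number of cuts to the
  offset probabilities in the window, with \<open>M = 1\<close> in the one-sided and
  \<open>M = 4 * l\<close> in the two-sided case. The upper bound on \<open>M * l\<close> keeps the
  mean number of cuts polylogarithmic; larger \<open>l\<close> is left to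
  \<open>expected_time_ge_1\<close>.\<close>

lemma expected_time_ge_scale:
  fixes l :: real
  assumes n: "1 \<le> ln (ln (real n))" "1 \<le> ln (real n)" "threshold n < n"
      "(ln (real n))\<^sup>2 * (3 + ln (2 * (real (threshold n))\<^sup>2)) / 12
        \<le> ln (ln (real n)) * (ln (real n + 1) - ln (real (threshold n) + 1))\<^sup>2"
    and q: "\<And>\<delta>. 0 \<le> q \<delta>" "\<And>N. (\<Sum>\<delta>\<in>{1..N}. q \<delta>) \<le> l"
    and M: "0 \<le> M" "1 \<le> M * l" "M * l \<le> 4 * (ln (real n))\<^sup>2"
    and \<F>: "\<And>I. I \<in> \<F> \<Longrightarrow> finite I" "\<And>I. I \<in> \<F> \<Longrightarrow> 0 \<notin> I" "\<And>I. I \<in> \<F> \<Longrightarrow> card I \<le> n" "{1..int n} \<in> \<F>"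
    and split: "\<And>I. I \<in> \<F> \<Longrightarrow> threshold n < card I \<Longrightarrow> \<exists>r :: int set \<Rightarrow> nat.
      (\<integral>\<^sup>+A. of_nat (r A) \<partial>measure_pmf D)
        \<le> ennreal (M * (\<Sum>\<delta> | card I < threshold n * \<delta> \<and> \<delta> \<le> 2 * card I. q \<delta>)) \<and>
      (\<forall>A\<in>set_pmf D. splits (threshold n) (r A) (det_step step A) \<F> I)"
    and X: "greedy_routing step D n X"
  shows "ennreal ((ln (real n))\<^sup>2 / ln (ln (real n)) / (48 * (M * l))) \<le> expected_time D n X"
proof -
  define L where "L = ln (real n)"
  define B where "B = threshold n"
  have L: "1 \<le> L" "1 \<le> ln L" using n by (simp_all add: L_def)
  have B_ge: "10 * L ^ 4 \<le> B" unfolding B_def threshold_def L_def by linarith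
  have L4: "1 \<le> L ^ 4" "L \<le> L ^ 4" "L\<^sup>2 \<le> L ^ 4"
    using L power_increasing[of 1 4 L] power_increasing[of 2 4 L] by simp_all
  \<comment> \<open>With \<open>\<epsilon> = 1 / L\<close> the share of \<open>\<epsilon>\<close> in
    the total speed is at most \<open>(1 + L) / L \<le> 2\<close>, while the potential stays at most
    \<open>L ^ 2 / 2\<close>.\<close>
  interpret log_potential q B M "1 / L"
  proof
    show "0 < B" using B_ge L4 by (auto intro!: Nat.gr0I)
    show "1 \<le> 1 / L * real B" using B_ge L L4 by (simp add: field_simps)
  qed (use q M L in auto)
  have n0: "0 < n" using n(3) by simp
  have small: "\<phi> k * (1 + window_mass k) \<le> B / 4" if "k \<le> n" for k
  proof -
    have "L \<le> L\<^sup>2" using L by (simp add: power2_eq_square)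
    have "\<phi> k \<le> (1 + L) * L / 4"
      using \<phi>_le[OF n0 that] L by (simp add: L_def)
    also have "\<dots> \<le> L\<^sup>2 / 2" using \<open>L \<le> L\<^sup>2\<close> by (simp add: power2_eq_square algebra_simps)
    finally have \<phi>: "\<phi> k \<le> L\<^sup>2 / 2" .
    have w: "1 + window_mass k \<le> 5 * L\<^sup>2"
      using window_mass_le[OF q(2), of k] M(3) L \<open>L \<le> L\<^sup>2\<close> by (simp add: L_def[symmetric])
    \<comment> \<open>The product of these two bounds is \<open>10 * L ^ 4 / 4\<close>; this
      explains the constant and the exponent in \<open>threshold\<close>.\<close>
    have "\<phi> k * (1 + window_mass k) \<le> L\<^sup>2 / 2 * (5 * L\<^sup>2)"
      using \<phi> w window_mass_nonneg[of k] by (intro mult_mono) auto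
    also have "\<dots> = 10 * L ^ 4 / 4" by (simp add: power_def numeral_eq_Suc)
    finally show ?thesis using B_ge by linarith
  qed
  have "ennreal (card {1..int n} * \<phi> (card {1..int n})) \<le> (\<Sum>x\<in>{1..int n}. mean_hops step D x)"
  proof (rule sum_mean_hops_ge_\<phi>[OF \<F>(1-3) small _ \<F>(4)])
    show "\<exists>r :: int set \<Rightarrow> nat. (\<integral>\<^sup>+A. of_nat (r A) \<partial>measure_pmf D) \<le> ennreal (window_mass (card I)) \<and>
      (\<forall>A\<in>set_pmf D. splits B (r A) (det_step step A) \<F> I)" if "I \<in> \<F>" "B < card I" for I
      using split[of I] that unfolding window_mass_def unfolding B_def by blast
  qed
  then have "ennreal (n * \<phi> n) / of_nat n \<le> (\<Sum>x\<in>{1..int n}. mean_hops step D x) / of_nat n"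
    by (intro divide_right_mono_ennreal) simp
  also have "\<dots> \<le> expected_time D n X" using expected_time_ge[OF X n0] .
  also have "ennreal (n * \<phi> n) / of_nat n = ennreal (\<phi> n)"
    using n0 \<phi>_nonneg[of n] by (simp add: ennreal_of_nat_eq_real_of_nat divide_ennreal)
  finally have "ennreal (\<phi> n) \<le> expected_time D n X" .
  moreover have "L\<^sup>2 / ln L / (48 * (M * l)) \<le> \<phi> n"
  proof -
    \<comment> \<open>\<open>C\<close> exceeds the factor \<open>1 + ln (2 * B ^ 2)\<close> of
      \<open>\<phi>_ge\<close> by 2, which absorbs the share of \<open>\<epsilon>\<close> because
      \<open>1 \<le> M * l\<close>. The constant 48 below is \<open>4 * 12\<close>.\<close>
    define C where "C = 3 + ln (2 * (real B)\<^sup>2)"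
    have "1 \<le> 2 * (real B)\<^sup>2" using B_pos one_le_power[of "real B" 2] by linarith
    then have C: "3 \<le> C" by (simp add: C_def)
    have "L\<^sup>2 * C / 12 \<le> ln L * (ln (real n + 1) - ln (real B + 1))\<^sup>2"
      using n(4) by (simp add: L_def B_def C_def)
    also have "\<dots> \<le> ln L * (4 * \<phi> n * (1 / L * (1 + L) + M * l * (C - 2)))"
      using \<phi>_ge[OF q(2), of n] n(3) L by (intro mult_left_mono) (auto simp: C_def L_def B_def)
    also have "\<dots> \<le> ln L * (4 * \<phi> n * (M * l * C))"
    proof (intro mult_left_mono)
      have "1 / L * (1 + L) \<le> 2" using L by (simp add: field_simps)
      then show "1 / L * (1 + L) + M * l * (C - 2) \<le> M * l * C"
        using M(2) by (simp add: algebra_simps)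
    qed (use L \<phi>_nonneg in auto)
    finally have "C * L\<^sup>2 \<le> C * (ln L * (48 * (M * l)) * \<phi> n)" by (simp add: algebra_simps)
    then have "L\<^sup>2 \<le> ln L * (48 * (M * l)) * \<phi> n" using C by simp
    moreover have "0 < ln L * (48 * (M * l))" by (rule mult_pos_pos) (use L M(2) in linarith)+
    ultimately show ?thesis by (simp only: divide_divide_eq_left pos_divide_le_eq mult.commute)
  qed
  ultimately show ?thesis
    by (metis L_def ennreal_leI order_trans)
qed

text \<open>Every start is nonzero and costs a hop. This settles the case of so many links that the
  claimed bound is below 1.\<close>

lemma expected_time_ge_1:
  assumes "greedy_routing step D n X" "0 < n"
  shows "1 \<le> expected_time D n X"
proof -
  have "(\<Sum>x\<in>{1..int n}. 1) \<le> (\<Sum>x\<in>{1..int n}. mean_hops step D x)"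
    by (intro sum_mono) (simp add: mean_hops_step)
  then have "of_nat n / of_nat n \<le> (\<Sum>x\<in>{1..int n}. mean_hops step D x) / of_nat n"
    by (intro divide_right_mono_ennreal) simp
  also have "\<dots> \<le> expected_time D n X" by (rule expected_time_ge[OF assms])
  also have "of_nat n / of_nat n = (1 :: ennreal)"
    using assms(2) by (intro ennreal_divide_self) (auto simp: of_nat_less_top)
  finally show ?thesis .
qed

section \<open>Inclusion probabilities and the mean number of links\<close>

lemma incl_prob_nonneg: "0 \<le> incl_prob D \<delta>"
  by (simp add: incl_prob_def)

lemma sum_incl_prob:
  assumes "finite S"
  shows "ennreal (\<Sum>\<delta>\<in>S. incl_prob D \<delta>) = (\<integral>\<^sup>+A. of_nat (card (A \<inter> S)) \<partial>measure_pmf D)"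
proof -
  have "ennreal (\<Sum>\<delta>\<in>S. incl_prob D \<delta>) = (\<Sum>\<delta>\<in>S. emeasure (measure_pmf D) {A. \<delta> \<in> A})"
    by (subst sum_ennreal[symmetric])
      (auto simp: incl_prob_nonneg, simp add: incl_prob_def measure_pmf.emeasure_eq_measure)
  also have "\<dots> = (\<integral>\<^sup>+A. (\<Sum>\<delta>\<in>S. indicator {A. \<delta> \<in> A} A) \<partial>measure_pmf D)"
    by (simp add: nn_integral_sum)
  also have "\<dots> = (\<integral>\<^sup>+A. of_nat (card (A \<inter> S)) \<partial>measure_pmf D)"
  proof (rule nn_integral_cong)
    fix A :: "int set"
    have "(\<Sum>\<delta>\<in>S. indicator {A. \<delta> \<in> A} A :: ennreal) = (\<Sum>\<delta>\<in>S. indicator A \<delta>)"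
      by (intro sum.cong) (auto simp: indicator_def)
    also have "\<dots> = of_nat (card (A \<inter> S))"
      using assms by (simp add: indicator_def Int_commute)
    finally show "(\<Sum>\<delta>\<in>S. indicator {A. \<delta> \<in> A} A :: ennreal) = of_nat (card (A \<inter> S))" .
  qed
  finally show ?thesis .
qed

lemma sum_incl_prob_le_mean_links:
  assumes "offset_distribution D" "finite S"
  shows "ennreal (\<Sum>\<delta>\<in>S. incl_prob D \<delta>) \<le> mean_links D"
  unfolding sum_incl_prob[OF assms(2)] mean_links_def
  using assms by (intro nn_integral_mono_AE)
    (auto simp: AE_measure_pmf_iff offset_distribution_def intro!: card_mono)

lemma one_le_mean_links:
  assumes "offset_distribution D"
  shows "1 \<le> mean_links D"
proof -
  have "incl_prob D 1 = 1"
    unfolding incl_prob_def using assms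
    by (intro measure_pmf.prob_eq_1[THEN iffD2]) (auto simp: AE_measure_pmf_iff offset_distribution_def)
  then show ?thesis
    using sum_incl_prob_le_mean_links[OF assms, of "{1}"] by simp
qed

subsection \<open>One-sided routing\<close>

text \<open>Induction on the greatest cut, which splits off the run to its right. The last clause
  records what precedes a run: in one-sided routing this integer is the offset that all nodes of the
  run use.\<close>

lemma interval_minus_runs:
  fixes a b :: int
  assumes "finite C" "C \<subseteq> {a..b}"
  shows "\<exists>P. finite P \<and> disjoint P \<and> \<Union>P = {a..b} - C \<and> card P \<le> card C + 1 \<and>
    (\<forall>p\<in>P. \<exists>u v. p = {u..v} \<and> u \<le> v \<and> (u = a \<or> u - 1 \<in> C))"
  using assms
proof (induction C arbitrary: b rule: finite_linorder_max_induct)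
  case empty
  show ?case
  proof (cases "a \<le> b")
    case True
    then show ?thesis by (intro exI[of _ "{{a..b}}"]) auto
  next
    case False
    then show ?thesis by (intro exI[of _ "{}"]) auto
  qed
next
  case (insert c C)
  have sub: "C \<subseteq> {a..c - 1}" using insert.hyps insert.prems by auto
  obtain P where P: "finite P" "disjoint P" "\<Union>P = {a..c - 1} - C" "card P \<le> card C + 1"
    "\<forall>p\<in>P. \<exists>u v. p = {u..v} \<and> u \<le> v \<and> (u = a \<or> u - 1 \<in> C)"
    using insert.IH[OF sub] by blast
  have c: "a \<le> c" "c \<le> b" "c \<notin> C" using insert.prems insert.hyps by auto
  have card: "card (insert c C) = card C + 1" using insert.hyps c by simp
  have less: "x < c" if "x \<in> p" "p \<in> P" for x p
  proof -
    have "x \<in> {a..c - 1} - C" unfolding P(3)[symmetric] using that by blast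
    then show ?thesis by simp
  qed
  show ?case
  proof (cases "c < b")
    case True
    let ?P = "insert {c + 1..b} P"
    have "disjoint ?P"
    proof (rule disjointI)
      fix p p' assume *: "p \<in> ?P" "p' \<in> ?P" "p \<noteq> p'"
      have "p'' \<inter> {c + 1..b} = {}" if "p'' \<in> P" for p''
        using less[OF _ that] by (fastforce simp: disjoint_iff)
      then show "p \<inter> p' = {}"
        using * disjointD[OF P(2)] by (metis Int_commute insert_iff)
    qed
    moreover have "\<Union>?P = {a..b} - insert c C"
      unfolding Union_insert P(3) using c sub by auto
    moreover have "card ?P \<le> card (insert c C) + 1"
      using card_insert_le_m1[of "card C + 2" P "{c + 1..b}"] P(4) card by simp
    moreover have "\<forall>p\<in>?P. \<exists>u v. p = {u..v} \<and> u \<le> v \<and> (u = a \<or> u - 1 \<in> insert c C)"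
    proof
      fix p assume "p \<in> ?P"
      then consider "p = {c + 1..b}" | "p \<in> P" by blast
      then show "\<exists>u v. p = {u..v} \<and> u \<le> v \<and> (u = a \<or> u - 1 \<in> insert c C)"
      proof cases
        case 1
        then show ?thesis using True by (intro exI[of _ "c + 1"] exI[of _ b]) auto
      next
        case 2
        then show ?thesis using P(5) by blast
      qed
    qed
    ultimately show ?thesis using P(1) by (intro exI[of _ ?P]) auto
  next
    case False
    then have "\<Union>P = {a..b} - insert c C" unfolding P(3) using c by auto
    then show ?thesis using P card by (intro exI[of _ P]) auto
  qed
qed

text \<open>The lost points are the cut points and the part of \<open>I\<close> outside
  \<open>{a..b}\<close>, so only the behaviour of \<open>g\<close> on runs remains to be
  checked.\<close>

lemma splits_runs:
  fixes a b :: int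
  assumes fin: "finite I" and sub: "{a..b} \<subseteq> I" and junk: "B * card (I - {a..b}) \<le> card I"
    and C: "C \<subseteq> {a..b}" "card C \<le> r"
    and runs: "\<And>u v. u \<le> v \<Longrightarrow> {u..v} \<subseteq> {a..b} - C \<Longrightarrow> u = a \<or> u - 1 \<in> C \<Longrightarrow> inj_on g {u..v} \<and> g ` {u..v} \<in> \<F>"
  shows "splits B r g \<F> I"
proof -
  have fC: "finite C" using C(1) finite_subset by blast
  obtain P where P: "finite P" "disjoint P" "\<Union>P = {a..b} - C" "card P \<le> card C + 1"
    "\<forall>p\<in>P. \<exists>u v. p = {u..v} \<and> u \<le> v \<and> (u = a \<or> u - 1 \<in> C)"
    using interval_minus_runs[OF fC C(1)] by blast
  have "I - \<Union>P = (I - {a..b}) \<union> C" using P(3) C(1) sub by auto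
  then have "card (I - \<Union>P) \<le> card (I - {a..b}) + card C" by (simp add: card_Un_le)
  then have "B * card (I - \<Union>P) \<le> B * (card (I - {a..b}) + r)"
    using C(2) by (intro mult_le_mono2) linarith
  then have "B * card (I - \<Union>P) \<le> card I + B * r"
    using junk by (simp add: distrib_left)
  moreover have "inj_on g p \<and> g ` p \<in> \<F>" if p: "p \<in> P" for p
  proof -
    obtain u v where uv: "p = {u..v}" "u \<le> v" "u = a \<or> u - 1 \<in> C" using P(5) p by blast
    have "{u..v} \<subseteq> {a..b} - C" using P(3) p uv(1) by blast
    then show ?thesis using runs uv by blast
  qed
  ultimately show ?thesis
    unfolding splits_def using P(1-4) C(2) sub by (intro exI[of _ P]) auto
qed

lemma det_step_one_sided:
  assumes "d \<in> A" "0 < d" "d \<le> x" "\<And>\<delta>. \<delta> \<in> A \<Longrightarrow> \<delta> \<le> x \<Longrightarrow> \<delta> \<le> d"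
  shows "det_step one_sided_step A x = x - d"
proof (rule det_step_eqI)
  show "one_sided_step A x (x - d)"
    using assms by (auto simp: one_sided_step_def neighbors_def)
  show "\<bar>x - d\<bar> < \<bar>x\<bar>" using assms by auto
  fix z assume z: "one_sided_step A x z"
  then have "z \<le> x - d" using assms by (auto simp: one_sided_step_def neighbors_def)
  moreover obtain \<delta> where "\<delta> \<in> A" "z = x - \<delta>" "0 \<le> z"
    using z by (auto simp: one_sided_step_def neighbors_def)
  then have "x - d \<le> z" using assms(4)[of \<delta>] by auto
  ultimately show "z = x - d" by simp
qed

text \<open>Nodes strictly between consecutive positive offsets all use the lower one, so a run is
  translated to an interval starting at 1. A node that is itself an offset goes straight to 0 and
  becomes a cut point.\<close>

lemma splits_one_sided:
  assumes A: "finite A" "1 \<in> A" and k: "B < k" "k \<le> n"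
  shows "splits B (card (A \<inter> int ` {\<delta>. k < B * \<delta> \<and> \<delta> \<le> 2 * k})) (det_step one_sided_step A)
    ((\<lambda>k. {1..int k}) ` {..n}) {1..int k}"
proof -
  let ?W = "int ` {\<delta>. k < B * \<delta> \<and> \<delta> \<le> 2 * k}"
  let ?S = "{\<delta> \<in> A. 0 < \<delta> \<and> int B * \<delta> \<le> int k}"
  \<comment> \<open>The largest offset not above \<open>k / B\<close>; it exists because
    \<open>1 \<in> A\<close> and \<open>B < k\<close>. Nodes up to \<open>d\<close> are given up,
    and by maximality all larger offsets exceed \<open>k / B\<close>.\<close>
  define d where "d = Max ?S"
  have "1 \<in> ?S" using A k by simp
  then have "d \<in> ?S" unfolding d_def using A(1) by (intro Max_in) (simp, blast)
  then have d: "d \<in> A" "0 < d" "int B * d \<le> int k" by auto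
  have max: "\<delta> \<le> d" if "\<delta> \<in> A" "0 < \<delta>" "int B * \<delta> \<le> int k" for \<delta>
    unfolding d_def using A(1) that by (intro Max_ge) auto
  show ?thesis
  proof (rule splits_runs[where a = "d + 1" and b = "int k" and C = "A \<inter> {d + 1..int k}"])
    show "{d + 1..int k} \<subseteq> {1..int k}" using d by auto
    show "B * card ({1..int k} - {d + 1..int k}) \<le> card {1..int k}"
    proof -
      have "card ({1..int k} - {d + 1..int k}) \<le> card {1..d}" by (intro card_mono) auto
      then have "B * card ({1..int k} - {d + 1..int k}) \<le> B * nat d" by simp
      also have "\<dots> = nat (int B * d)" by (simp add: nat_mult_distrib)
      also have "\<dots> \<le> k" using d by simp
      finally show ?thesis by simp
    qed
    show "card (A \<inter> {d + 1..int k}) \<le> card (A \<inter> ?W)"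
    proof (intro card_mono)
      show "A \<inter> {d + 1..int k} \<subseteq> A \<inter> ?W"
      proof
        fix x assume x: "x \<in> A \<inter> {d + 1..int k}"
        then have "int k < int B * x" using max[of x] d by force
        moreover have x_eq: "x = int (nat x)" using x d by simp
        ultimately have "k < B * nat x" by (metis of_nat_less_iff of_nat_mult)
        moreover have "nat x \<le> 2 * k" using x by auto
        ultimately show "x \<in> A \<inter> ?W" using x x_eq by blast
      qed
    qed (use A in auto)
    fix u v assume uv: "u \<le> v" "{u..v} \<subseteq> {d + 1..int k} - A \<inter> {d + 1..int k}"
      "u = d + 1 \<or> u - 1 \<in> A \<inter> {d + 1..int k}"
    \<comment> \<open>The integer before a run is \<open>d\<close> or a cut point, hence an
      offset.\<close>
    have u1: "u - 1 \<in> A" "0 < u - 1" using uv d by auto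
    have notA: "\<delta> \<notin> A" if "u \<le> \<delta>" "\<delta> \<le> v" for \<delta>
      using uv(2) that by auto
    have step: "det_step one_sided_step A x = x - (u - 1)" if x: "x \<in> {u..v}" for x
    proof (rule det_step_one_sided[OF u1])
      fix \<delta> assume "\<delta> \<in> A" "\<delta> \<le> x"
      then show "\<delta> \<le> u - 1" using notA[of \<delta>] x by (cases "u \<le> \<delta>") auto
    qed (use x in auto)
    have "v \<le> int k" using uv(1,2) by auto
    have "det_step one_sided_step A ` {u..v} = (\<lambda>x. x + (1 - u)) ` {u..v}"
      using step by (intro image_cong) auto
    also have "\<dots> = {1..int (nat (v - u + 1))}"
      using uv(1) by (simp only: image_add_atLeastAtMost') simp
    finally have "det_step one_sided_step A ` {u..v} = {1..int (nat (v - u + 1))}" .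
    moreover have "nat (v - u + 1) \<le> n" using \<open>v \<le> int k\<close> k u1 by simp
    moreover have "inj_on (det_step one_sided_step A) {u..v}"
      by (intro inj_onI) (use step in auto)
    ultimately show "inj_on (det_step one_sided_step A) {u..v} \<and>
        det_step one_sided_step A ` {u..v} \<in> (\<lambda>k. {1..int k}) ` {..n}" by blast
  qed auto
qed

subsection \<open>Two-sided routing\<close>

lemma det_step_two_sided:
  assumes "d \<in> A" "1 \<in> A" "0 < x" and near: "\<And>e. e \<in> A \<Longrightarrow> e \<noteq> d \<Longrightarrow> \<bar>x - d\<bar> < \<bar>x - e\<bar>"
  shows "det_step two_sided_step A x = x - d"
proof (rule det_step_eqI)
  show "two_sided_step A x (x - d)"
    unfolding two_sided_step_def neighbors_def
  proof (intro conjI ballI)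
    fix z assume "z \<in> (\<lambda>\<delta>. x - \<delta>) ` A"
    then obtain e where "e \<in> A" "z = x - e" by blast
    then show "\<bar>x - d\<bar> \<le> \<bar>z\<bar>" using near[of e] by (cases "e = d") auto
  qed (use assms in auto)
  have "\<bar>x - d\<bar> \<le> \<bar>x - 1\<bar>" using near[of 1] assms(2) by (cases "d = 1") auto
  then show "\<bar>x - d\<bar> < \<bar>x\<bar>" using assms(3) by auto
  fix z assume z: "two_sided_step A x z"
  then obtain e where e: "e \<in> A" "z = x - e" by (auto simp: two_sided_step_def neighbors_def)
  have "\<bar>z\<bar> \<le> \<bar>x - d\<bar>" using z assms(1) by (auto simp: two_sided_step_def neighbors_def)
  then show "z = x - d" using near[OF e(1)] e(2) by force
qed

text \<open>Away from cuts the step is locally a translation and avoids 0. Ties count as cuts,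
  because \<open>det_step\<close> is 0 there.\<close>

definition is_cut :: "int set \<Rightarrow> int \<Rightarrow> bool" where
  "is_cut A x \<longleftrightarrow> det_step two_sided_step A x = 0 \<or>
     det_step two_sided_step A (x + 1) \<noteq> det_step two_sided_step A x + 1"

text \<open>Let \<open>d\<close> be an offset nearest to \<open>x\<close>. A tie with
  \<open>e\<close> means \<open>d + e = 2 * x\<close>. If \<open>d\<close> is not the unique nearest
  offset to \<open>x + 1\<close>, a competitor \<open>e\<close> satisfies \<open>d < e\<close> and
  \<open>2 * x < d + e \<le> 2 * x + 2\<close>. Otherwise both nodes move by \<open>d\<close>, and a
  cut forces \<open>x = d\<close>.\<close>

lemma cut_imp_offset_or_midpoint:
  assumes A: "finite A" "1 \<in> A" and x: "0 < x" and cut: "is_cut A x"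
  shows "x \<in> A \<or> (\<exists>d\<in>A. \<exists>e\<in>A. 0 < d \<and> d < e \<and> d + e \<in> {2 * x, 2 * x + 1, 2 * x + 2})"
proof (rule ccontr)
  assume contra: "\<not> ?thesis"
  then have pair: "\<And>d e. d \<in> A \<Longrightarrow> e \<in> A \<Longrightarrow> 0 < d \<Longrightarrow> d < e \<Longrightarrow> d + e \<notin> {2 * x, 2 * x + 1, 2 * x + 2}"
    by blast
  obtain d where d: "d \<in> A" "\<And>e. e \<in> A \<Longrightarrow> \<bar>x - d\<bar> \<le> \<bar>x - e\<bar>"
    using ex_is_arg_min_if_finite[of A "\<lambda>e. \<bar>x - e\<bar>"] A by (auto simp: is_arg_min_linorder)
  \<comment> \<open>The offset 1 is closer to \<open>x\<close> than any nonpositive offset.\<close>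
  have d0: "0 < d" using d(2)[OF A(2)] x by linarith
  have strict: "\<bar>x - d\<bar> < \<bar>x - e\<bar>" if e: "e \<in> A" "e \<noteq> d" for e
  proof (rule ccontr)
    assume "\<not> ?thesis"
    then have eq: "\<bar>x - d\<bar> = \<bar>x - e\<bar>" using d(2)[OF e(1)] by simp
    then have "d + e = 2 * x" "0 < e" using e(2) d(2)[OF A(2)] x by linarith+
    then show False using pair[OF d(1) e(1)] pair[OF e(1) d(1)] d0 e(2) by force
  qed
  have gx: "det_step two_sided_step A x = x - d"
    by (rule det_step_two_sided[OF d(1) A(2) x strict])
  moreover have "x \<noteq> d" using d(1) contra by blast
  ultimately have "det_step two_sided_step A (x + 1) \<noteq> x + 1 - d"
    using cut by (auto simp: is_cut_def)
  then obtain e where e: "e \<in> A" "e \<noteq> d" "\<bar>x + 1 - e\<bar> \<le> \<bar>x + 1 - d\<bar>"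
    using det_step_two_sided[OF d(1) A(2), of "x + 1"] x by fastforce
  then have "d < e \<and> d + e \<in> {2 * x, 2 * x + 1, 2 * x + 2}"
    using strict[OF e(1,2)] by auto
  then show False using pair[OF d(1) e(1) d0] by blast
qed

text \<open>Of two offsets with midpoint near \<open>x\<close>, the larger one is at least \<open>x\<close>, so by unimodality its
  probability is at most that of \<open>x\<close>; summing over the smaller one costs a factor \<open>l\<close>.\<close>

lemma prob_cut_le:
  assumes D: "offset_distribution D" and x: "0 < x"
    and mono: "\<And>\<delta> \<delta>'. 0 < \<delta> \<Longrightarrow> \<delta> \<le> \<delta>' \<Longrightarrow> incl_prob D \<delta>' \<le> incl_prob D \<delta>"
    and indep: "\<And>d e. d \<noteq> e \<Longrightarrow> measure_pmf.prob D {A. d \<in> A \<and> e \<in> A} = incl_prob D d * incl_prob D e"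
    and l: "\<And>S. finite S \<Longrightarrow> (\<Sum>\<delta>\<in>S. incl_prob D \<delta>) \<le> l"
  shows "measure_pmf.prob D {A. is_cut A x} \<le> incl_prob D x * (1 + 3 * l)"
proof -
  \<comment> \<open>Pairs with sum \<open>s\<close> are indexed by their smaller member
    \<open>d\<close>: \<open>2 * d < s\<close> makes the two offsets distinct, so independence
    applies, and \<open>d \<le> x\<close> gives \<open>x \<le> s - d\<close>.\<close>
  let ?S = "\<lambda>s. {1..x} \<inter> {d. 2 * d < s}"
  let ?E = "\<lambda>s. \<Union>d\<in>?S s. {A. d \<in> A \<and> s - d \<in> A}"
  have E: "measure_pmf.prob D (?E s) \<le> incl_prob D x * l" if s: "s \<in> {2 * x, 2 * x + 1, 2 * x + 2}" for s
  proof -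
    have "measure_pmf.prob D (?E s) \<le> (\<Sum>d\<in>?S s. measure_pmf.prob D {A. d \<in> A \<and> s - d \<in> A})"
      by (intro measure_UNION_le) auto
    also have "\<dots> = (\<Sum>d\<in>?S s. incl_prob D d * incl_prob D (s - d))"
      by (intro sum.cong refl indep) auto
    also have "\<dots> \<le> (\<Sum>d\<in>?S s. incl_prob D d * incl_prob D x)"
      using s x by (intro sum_mono mult_left_mono mono incl_prob_nonneg) auto
    also have "\<dots> \<le> l * incl_prob D x"
      unfolding sum_distrib_right[symmetric] by (intro mult_right_mono l incl_prob_nonneg) auto
    finally show ?thesis by (simp add: mult.commute)
  qed
  have "measure_pmf.prob D {A. is_cut A x} = measure_pmf.prob D ({A. is_cut A x} \<inter> set_pmf D)"
    by (rule measure_Int_set_pmf[symmetric])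
  also have "\<dots> \<le> measure_pmf.prob D ({A. x \<in> A} \<union> (\<Union>s\<in>{2 * x, 2 * x + 1, 2 * x + 2}. ?E s))"
  proof (rule measure_pmf.finite_measure_mono)
    show "{A. is_cut A x} \<inter> set_pmf D \<subseteq> {A. x \<in> A} \<union> (\<Union>s\<in>{2 * x, 2 * x + 1, 2 * x + 2}. ?E s)"
    proof
      fix A assume A: "A \<in> {A. is_cut A x} \<inter> set_pmf D"
      then have "finite A" "1 \<in> A" using D by (auto simp: offset_distribution_def)
      then consider "x \<in> A"
        | d e where "d \<in> A" "e \<in> A" "0 < d" "d < e" "d + e \<in> {2 * x, 2 * x + 1, 2 * x + 2}"
        using cut_imp_offset_or_midpoint[of A x] A x by blast
      then show "A \<in> {A. x \<in> A} \<union> (\<Union>s\<in>{2 * x, 2 * x + 1, 2 * x + 2}. ?E s)"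
      proof cases
        case 2
        then have "d \<in> ?S (d + e)" by auto
        then have "A \<in> ?E (d + e)" by (rule UN_I) (use 2(1,2) in simp)
        then show ?thesis using 2(5) by blast
      qed auto
    qed
  qed simp
  also have "\<dots> \<le> incl_prob D x + measure_pmf.prob D (\<Union>s\<in>{2 * x, 2 * x + 1, 2 * x + 2}. ?E s)"
    unfolding incl_prob_def by (rule measure_Un_le) auto
  also have "measure_pmf.prob D (\<Union>s\<in>{2 * x, 2 * x + 1, 2 * x + 2}. ?E s)
      \<le> (\<Sum>s\<in>{2 * x, 2 * x + 1, 2 * x + 2}. measure_pmf.prob D (?E s))"
    by (rule measure_UNION_le) auto
  also have "\<dots> \<le> (\<Sum>s\<in>{2 * x, 2 * x + 1, 2 * x + 2}. incl_prob D x * l)"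
    by (intro sum_mono E)
  also have "\<dots> = incl_prob D x * (3 * l)" by simp
  finally show ?thesis by (simp add: distrib_left)
qed

text \<open>By monotonicity the interval may be slid left until it starts just above
  \<open>k / B\<close>. Having at most \<open>k\<close> points, it then ends no later than
  \<open>2 * k\<close>, the upper end of the window.\<close>

lemma sum_incl_prob_shift_le:
  fixes a b :: int
  assumes mono: "\<And>\<delta> \<delta>'. 0 < \<delta> \<Longrightarrow> \<delta> \<le> \<delta>' \<Longrightarrow> incl_prob D \<delta>' \<le> incl_prob D \<delta>"
    and ab: "int (k div B) < a" "b - a < int k" and B: "0 < B"
  shows "(\<Sum>x\<in>{a..b}. incl_prob D x) \<le> (\<Sum>\<delta> | k < B * \<delta> \<and> \<delta> \<le> 2 * k. incl_prob D (int \<delta>))"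
proof -
  define u where "u = int (k div B) + 1"
  let ?W = "{\<delta>. k < B * \<delta> \<and> \<delta> \<le> 2 * k}"
  have u: "0 < u" "u \<le> a" using ab by (auto simp: u_def)
  have "(\<Sum>x\<in>{a..b}. incl_prob D x) \<le> (\<Sum>x\<in>{a..b}. incl_prob D (x + (u - a)))"
    using u by (intro sum_mono mono) auto
  also have "\<dots> = (\<Sum>x\<in>(\<lambda>x. x + (u - a)) ` {a..b}. incl_prob D x)"
    by (subst sum.reindex) (auto simp: inj_on_def)
  also have "\<dots> \<le> (\<Sum>x\<in>int ` ?W. incl_prob D x)"
  proof (intro sum_mono2 incl_prob_nonneg)
    show "(\<lambda>x. x + (u - a)) ` {a..b} \<subseteq> int ` ?W"
    proof
      fix y assume "y \<in> (\<lambda>x. x + (u - a)) ` {a..b}"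
      then have y: "u \<le> y" "y \<le> u + (b - a)" by auto
      have "int (k div B) \<le> int k" by (intro of_nat_mono div_le_dividend)
      then have "nat y \<le> 2 * k" using y ab unfolding u_def by linarith
      moreover have "Suc (k div B) \<le> nat y" using y by (simp add: u_def)
      then have "k div B < nat y" by simp
      then have "k < nat y * B" using B by (simp add: div_less_iff_less_mult)
      then have "k < B * nat y" by (simp add: mult.commute)
      ultimately show "y \<in> int ` ?W" using y u by (intro image_eqI[of _ _ "nat y"]) auto
    qed
    show "finite (int ` ?W)" by (intro finite_imageI finite_subset[of ?W "{..2 * k}"]) auto
  qed
  also have "\<dots> = (\<Sum>\<delta>\<in>?W. incl_prob D (int \<delta>))" by (subst sum.reindex) auto
  finally show ?thesis .
qed

definition zero_free_intervals :: "nat \<Rightarrow> int set set" where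
  "zero_free_intervals n = {I. (\<exists>a b. I = {a..b}) \<and> 0 \<notin> I \<and> card I \<le> n}"

text \<open>Points up to \<open>k / B\<close> are given up. Beyond them the mean number of cuts is
  the sum of the cut probabilities, where \<open>1 + 3 * l \<le> 4 * l\<close> since
  \<open>1 \<le> l\<close>.\<close>

lemma splits_two_sided_pos:
  assumes D: "offset_distribution D"
    and mono: "\<And>\<delta> \<delta>'. 0 < \<delta> \<Longrightarrow> \<delta> \<le> \<delta>' \<Longrightarrow> incl_prob D \<delta>' \<le> incl_prob D \<delta>"
    and indep: "\<And>d e. d \<noteq> e \<Longrightarrow> measure_pmf.prob D {A. d \<in> A \<and> e \<in> A} = incl_prob D d * incl_prob D e"
    and l: "\<And>S. finite S \<Longrightarrow> (\<Sum>\<delta>\<in>S. incl_prob D \<delta>) \<le> l" "1 \<le> l"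
    and I: "I = {c..d}" "0 < c" "card I \<le> n" and B: "0 < B"
  shows "\<exists>r :: int set \<Rightarrow> nat. (\<integral>\<^sup>+A. of_nat (r A) \<partial>measure_pmf D)
        \<le> ennreal (4 * l * (\<Sum>\<delta> | card I < B * \<delta> \<and> \<delta> \<le> 2 * card I. incl_prob D (int \<delta>))) \<and>
      (\<forall>A\<in>set_pmf D. splits B (r A) (det_step two_sided_step A) (zero_free_intervals n) I)"
proof -
  define k where "k = card I"
  define a where "a = max c (int (k div B) + 1)"
  define C where "C A = {a..d} \<inter> {x. is_cut A x}" for A
  have k: "k = nat (d - c + 1)" by (simp add: k_def I)
  have a: "0 < a" "c \<le> a" "int (k div B) < a" by (auto simp: a_def)
  have "(\<integral>\<^sup>+A. of_nat (card (C A)) \<partial>measure_pmf D)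
      = (\<integral>\<^sup>+A. (\<Sum>x\<in>{a..d}. indicator {A. is_cut A x} A) \<partial>measure_pmf D)"
  proof (rule nn_integral_cong)
    fix A :: "int set"
    show "of_nat (card (C A)) = (\<Sum>x\<in>{a..d}. indicator {A. is_cut A x} A :: ennreal)"
      by (simp add: C_def indicator_def)
  qed
  also have "\<dots> = (\<Sum>x\<in>{a..d}. emeasure (measure_pmf D) {A. is_cut A x})"
    by (simp add: nn_integral_sum)
  also have "\<dots> \<le> (\<Sum>x\<in>{a..d}. ennreal (4 * l * incl_prob D x))"
  proof (intro sum_mono)
    fix x assume "x \<in> {a..d}"
    then have "measure_pmf.prob D {A. is_cut A x} \<le> incl_prob D x * (1 + 3 * l)"
      using a by (intro prob_cut_le D mono indep l) auto
    also have "\<dots> \<le> incl_prob D x * (4 * l)"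
      using l(2) by (intro mult_left_mono incl_prob_nonneg) auto
    finally show "emeasure (measure_pmf D) {A. is_cut A x} \<le> ennreal (4 * l * incl_prob D x)"
      by (simp add: measure_pmf.emeasure_eq_measure mult_ac ennreal_leI)
  qed
  also have "\<dots> = ennreal (4 * l * (\<Sum>x\<in>{a..d}. incl_prob D x))"
    using l(2) by (simp add: incl_prob_nonneg sum_distrib_left)
  also have "\<dots> \<le> ennreal (4 * l * (\<Sum>\<delta> | k < B * \<delta> \<and> \<delta> \<le> 2 * k. incl_prob D (int \<delta>)))"
  proof (cases "a \<le> d")
    case True
    then have "d - a < int k" using a k by simp
    then show ?thesis
      using l(2) a B by (intro ennreal_leI mult_left_mono sum_incl_prob_shift_le mono) auto
  qed simp
  finally have int: "(\<integral>\<^sup>+A. of_nat (card (C A)) \<partial>measure_pmf D)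
      \<le> ennreal (4 * l * (\<Sum>\<delta> | k < B * \<delta> \<and> \<delta> \<le> 2 * k. incl_prob D (int \<delta>)))" .
  have "splits B (card (C A)) (det_step two_sided_step A) (zero_free_intervals n) I" for A
  proof (rule splits_runs[where a = a and b = d and C = "C A"])
    show "finite I" "{a..d} \<subseteq> I" "C A \<subseteq> {a..d}" using a by (auto simp: I C_def)
    show "B * card (I - {a..d}) \<le> card I"
    proof -
      have "I - {a..d} \<subseteq> {1..int (k div B)}" using I(2) by (auto simp: I(1) a_def)
      then have "card (I - {a..d}) \<le> card {1..int (k div B)}" by (intro card_mono) auto
      then have "B * card (I - {a..d}) \<le> B * (k div B)" by simp
      also have "\<dots> \<le> k" by simp
      finally show ?thesis by (simp add: k_def)
    qed
    fix u v assume uv: "u \<le> v" "{u..v} \<subseteq> {a..d} - C A"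
    let ?g = "det_step two_sided_step A"
    have nc: "\<not> is_cut A x" if "x \<in> {u..v}" for x
      using uv(2) that by (auto simp: C_def)
    \<comment> \<open>Each node that is not a cut passes the same displacement on to its right
      neighbour.\<close>
    have shift: "u + int i \<le> v \<Longrightarrow> ?g (u + int i) = ?g u + int i" for i
    proof (induction i)
      case (Suc i)
      then show ?case using nc[of "u + int i"] by (auto simp: is_cut_def add_ac)
    qed simp
    have g: "?g x = x + (?g u - u)" if "x \<in> {u..v}" for x
      using shift[of "nat (x - u)"] that by simp
    have img: "?g ` {u..v} = {?g u..v + (?g u - u)}"
    proof -
      have "?g ` {u..v} = (\<lambda>x. x + (?g u - u)) ` {u..v}" by (rule image_cong[OF refl g])
      then show ?thesis by (simp only: image_add_atLeastAtMost') simp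
    qed
    have "0 \<notin> ?g ` {u..v}" using nc by (auto simp: is_cut_def)
    moreover have inj: "inj_on ?g {u..v}"
    proof (rule inj_onI)
      fix x y assume "x \<in> {u..v}" "y \<in> {u..v}" "?g x = ?g y"
      then show "x = y" using g[of x] g[of y] by linarith
    qed
    moreover have "card (?g ` {u..v}) \<le> n"
    proof -
      have "card (?g ` {u..v}) = card {u..v}" by (rule card_image[OF inj])
      also have "\<dots> \<le> card I" using uv(2) a by (intro card_mono) (auto simp: I(1))
      finally show ?thesis using I(3) by simp
    qed
    ultimately show "inj_on ?g {u..v} \<and> ?g ` {u..v} \<in> zero_free_intervals n"
      using img by (auto simp: zero_free_intervals_def)
  qed simp
  then show ?thesis using int unfolding k_def[symmetric] by (intro exI[of _ "\<lambda>A. card (C A)"]) blast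
qed

section \<open>Reflection, for intervals to the left of 0\<close>

lemma det_step_two_sided_uminus:
  "det_step two_sided_step (uminus ` A) x = - det_step two_sided_step A (- x)"
proof -
  have step: "two_sided_step (uminus ` A) x y \<longleftrightarrow> two_sided_step A (- x) (- y)" for y
  proof -
    have "neighbors (uminus ` A) x = uminus ` neighbors A (- x)"
      by (auto simp: neighbors_def image_image)
    moreover have "y \<in> uminus ` S \<longleftrightarrow> - y \<in> S" for S by force
    ultimately show ?thesis by (simp add: two_sided_step_def)
  qed
  have ex1: "(\<exists>!y. two_sided_step (uminus ` A) x y) \<longleftrightarrow> (\<exists>!y. two_sided_step A (- x) y)"
  proof -
    have *: "\<exists>!y. Q (- y)" if Q: "\<exists>!y. Q y" for Q :: "int \<Rightarrow> bool"
    proof -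
      obtain y where y: "Q y" "\<And>z. Q z \<Longrightarrow> z = y" using Q by blast
      show ?thesis
      proof (rule ex1I[of _ "- y"])
        show "Q (- (- y))" using y(1) by simp
        show "z = - y" if "Q (- z)" for z using y(2)[OF that] by simp
      qed
    qed
    show ?thesis
      unfolding step using *[of "two_sided_step A (- x)"] *[of "\<lambda>y. two_sided_step A (- x) (- y)"]
      by (simp only: minus_minus) blast
  qed
  show ?thesis
  proof (cases "\<exists>!y. two_sided_step A (- x) y")
    case True
    then obtain y where y: "two_sided_step A (- x) y" "\<And>z. two_sided_step A (- x) z \<Longrightarrow> z = y" by blast
    have "(THE y. two_sided_step A (- x) y) = y" using y by (rule the_equality)
    moreover have "(THE y. two_sided_step (uminus ` A) x y) = - y"
      unfolding step
    proof (rule the_equality)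
      show "two_sided_step A (- x) (- (- y))" using y(1) by simp
      show "z = - y" if "two_sided_step A (- x) (- z)" for z using y(2)[OF that] by simp
    qed
    ultimately show ?thesis unfolding det_step_def ex1 by simp
  qed (simp add: det_step_def ex1)
qed

lemma uminus_zero_free_intervals: "uminus ` I \<in> zero_free_intervals n \<longleftrightarrow> I \<in> zero_free_intervals n"
proof -
  have *: "uminus ` I \<in> zero_free_intervals n" if I: "I \<in> zero_free_intervals n" for I
  proof -
    obtain a b where ab: "I = {a..b}" "0 \<notin> I" "card I \<le> n"
      using I unfolding zero_free_intervals_def by blast
    have "uminus ` I = {- b..- a}" by (simp add: ab(1))
    moreover have "0 \<notin> uminus ` I" using ab(2) by force
    moreover have "card (uminus ` I) \<le> n" using ab(3) by (simp only: card_image inj_uminus)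
    ultimately show ?thesis
      unfolding zero_free_intervals_def by (intro CollectI conjI exI[of _ "- b"] exI[of _ "- a"])
  qed
  show ?thesis
    using *[of I] *[of "uminus ` I"] by (auto simp: image_image)
qed

text \<open>The pieces of a splitting of the mirror image are reflected back; their images under
  \<open>g\<close> are then reflections of members of \<open>\<F>\<close>.\<close>

lemma splits_uminus:
  assumes "splits B r (\<lambda>x. - g (- x)) \<F> (uminus ` I)" and \<F>: "\<And>I. I \<in> \<F> \<Longrightarrow> uminus ` I \<in> \<F>"
  shows "splits B r g \<F> I"
proof -
  obtain P where P: "finite P" "disjoint P" "\<Union>P \<subseteq> uminus ` I"
    "\<And>p. p \<in> P \<Longrightarrow> inj_on (\<lambda>x. - g (- x)) p" "\<And>p. p \<in> P \<Longrightarrow> (\<lambda>x. - g (- x)) ` p \<in> \<F>"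
    "card P \<le> r + 1" "B * card (uminus ` I - \<Union>P) \<le> card (uminus ` I) + B * r"
    using assms(1) unfolding splits_def by blast
  let ?P = "(image uminus) ` P"
  have U: "\<Union>?P = uminus ` \<Union>P" by auto
  have "disjoint ?P"
  proof (rule disjointI)
    fix p p' assume "p \<in> ?P" "p' \<in> ?P" "p \<noteq> p'"
    then obtain s s' where "s \<in> P" "s' \<in> P" "s \<noteq> s'" "p = uminus ` s" "p' = uminus ` s'" by blast
    then show "p \<inter> p' = {}" using disjointD[OF P(2)] by (metis image_Int image_empty inj_uminus)
  qed
  moreover have "\<Union>?P \<subseteq> I" unfolding U using P(3) by force
  moreover have "inj_on g p \<and> g ` p \<in> \<F>" if p: "p \<in> ?P" for p
  proof -
    obtain s where s: "s \<in> P" "p = uminus ` s" using p by blast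
    have "inj_on g p"
    proof (rule inj_onI)
      fix x y assume "x \<in> p" "y \<in> p" "g x = g y"
      then have "- x \<in> s" "- y \<in> s" "- g (- (- x)) = - g (- (- y))" using s(2) by auto
      then show "x = y" using inj_onD[OF P(4)[OF s(1)]] by fastforce
    qed
    moreover have "g ` p = uminus ` ((\<lambda>x. - g (- x)) ` s)" by (simp add: s(2) image_image)
    ultimately show ?thesis using \<F>[OF P(5)[OF s(1)]] by simp
  qed
  moreover have "card ?P \<le> r + 1" using card_image_le[OF P(1)] P(6) by (rule le_trans)
  moreover have "B * card (I - \<Union>?P) \<le> card I + B * r"
  proof -
    have "uminus ` (I - \<Union>?P) = uminus ` I - \<Union>P"
      unfolding U by (simp add: image_set_diff image_image)
    then have "card (I - \<Union>?P) = card (uminus ` I - \<Union>P)" by (metis card_image inj_uminus)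
    moreover have "card (uminus ` I) = card I" by (intro card_image inj_uminus)
    ultimately show ?thesis using P(7) by simp
  qed
  ultimately show ?thesis unfolding splits_def using P(1) by (intro exI[of _ ?P]) auto
qed


text \<open>Since \<open>incl_prob D\<close> is symmetric, negating all offsets preserves the
  inclusion probabilities and the product rule for pairs. An interval left of 0 is therefore handled
  as its mirror image under the reflected distribution.\<close>

lemma splits_two_sided:
  assumes D: "offset_distribution D" and uni: "unimodal (incl_prob D)"
    and sym: "\<And>\<delta>. incl_prob D \<delta> = incl_prob D (- \<delta>)" and indep: "pairwise_indep_offsets D"
    and l: "\<And>S. finite S \<Longrightarrow> (\<Sum>\<delta>\<in>S. incl_prob D \<delta>) \<le> l" "1 \<le> l"
    and I: "I \<in> zero_free_intervals n" and B: "0 < B" "B < card I"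
  shows "\<exists>r :: int set \<Rightarrow> nat. (\<integral>\<^sup>+A. of_nat (r A) \<partial>measure_pmf D)
        \<le> ennreal (4 * l * (\<Sum>\<delta> | card I < B * \<delta> \<and> \<delta> \<le> 2 * card I. incl_prob D (int \<delta>))) \<and>
      (\<forall>A\<in>set_pmf D. splits B (r A) (det_step two_sided_step A) (zero_free_intervals n) I)"
proof -
  have mono: "incl_prob D \<delta>' \<le> incl_prob D \<delta>" if "0 < \<delta>" "\<delta> \<le> \<delta>'" for \<delta> \<delta>'
    using uni that by (auto simp: unimodal_def)
  have prod: "measure_pmf.prob D {A. d \<in> A \<and> e \<in> A} = incl_prob D d * incl_prob D e" if "d \<noteq> e" for d e
  proof -
    have "prob_space.indep_event (measure_pmf D) {A. d \<in> A} {A. e \<in> A}"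
      using indep that by (auto simp: pairwise_indep_offsets_def)
    then have "measure_pmf.prob D (\<Inter>j\<in>UNIV. case_bool {A. d \<in> A} {A. e \<in> A} j)
        = (\<Prod>j\<in>UNIV. measure_pmf.prob D (case_bool {A. d \<in> A} {A. e \<in> A} j))"
      unfolding prob_space.indep_event_def[OF measure_pmf.prob_space_axioms]
        prob_space.indep_events_def[OF measure_pmf.prob_space_axioms]
      by (elim conjE allE[of _ UNIV]) simp
    then show ?thesis by (simp add: UNIV_bool incl_prob_def Int_def mult.commute conj_commute)
  qed
  obtain a b where ab: "I = {a..b}" "0 \<notin> I" "card I \<le> n"
    using I unfolding zero_free_intervals_def by blast
  have "a \<le> b" using B(2) ab(1) by (auto simp: not_le[symmetric])
  then consider "0 < a" | "b < 0" using ab(1,2) by fastforce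
  then show ?thesis
  proof cases
    case 1
    then show ?thesis
      using splits_two_sided_pos[OF D mono prod l ab(1) _ ab(3) B(1)] by blast
  next
    case 2
    let ?D = "map_pmf (image uminus) D" and ?I = "{- b..- a}"
    have mem: "x \<in> uminus ` S \<longleftrightarrow> - x \<in> S" for x :: int and S by force
    have p: "incl_prob ?D \<delta> = incl_prob D \<delta>" for \<delta>
      by (simp add: incl_prob_def[of ?D] vimage_def mem sym[of \<delta>]) (simp add: incl_prob_def)
    have D': "offset_distribution ?D"
      using D by (auto simp: offset_distribution_def mem)
    have prod': "measure_pmf.prob ?D {A. d \<in> A \<and> e \<in> A} = incl_prob ?D d * incl_prob ?D e" if "d \<noteq> e" for d e
      using prod[of "- d" "- e"] that sym[of d] sym[of e] by (simp add: p vimage_def mem)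
    have uI: "uminus ` I = ?I" by (simp add: ab(1))
    then have cI: "card ?I = card I" by (metis card_image inj_uminus)
    have "\<exists>r :: int set \<Rightarrow> nat. (\<integral>\<^sup>+A. of_nat (r A) \<partial>measure_pmf ?D)
        \<le> ennreal (4 * l * (\<Sum>\<delta> | card ?I < B * \<delta> \<and> \<delta> \<le> 2 * card ?I. incl_prob ?D (int \<delta>))) \<and>
      (\<forall>A\<in>set_pmf ?D. splits B (r A) (det_step two_sided_step A) (zero_free_intervals n) ?I)"
    proof (rule splits_two_sided_pos[OF D' _ prod' _ l(2) refl _ _ B(1)])
      show "card ?I \<le> n" unfolding cI by (rule ab(3))
    qed (use mono l(1) 2 in \<open>simp_all add: p\<close>)
    then obtain r where r: "(\<integral>\<^sup>+A. of_nat (r A) \<partial>measure_pmf ?D)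
        \<le> ennreal (4 * l * (\<Sum>\<delta> | card I < B * \<delta> \<and> \<delta> \<le> 2 * card I. incl_prob D (int \<delta>)))"
      "\<And>A. A \<in> set_pmf ?D \<Longrightarrow> splits B (r A) (det_step two_sided_step A) (zero_free_intervals n) ?I"
      unfolding cI p by blast
    have "splits B (r (uminus ` A)) (det_step two_sided_step A) (zero_free_intervals n) I"
      if "A \<in> set_pmf D" for A
    proof (rule splits_uminus)
      have "det_step two_sided_step (uminus ` A) = (\<lambda>x. - det_step two_sided_step A (- x))"
        by (rule ext) (rule det_step_two_sided_uminus)
      then show "splits B (r (uminus ` A)) (\<lambda>x. - det_step two_sided_step A (- x)) (zero_free_intervals n) (uminus ` I)"
        using r(2)[of "uminus ` A"] that uI by auto
    qed (simp add: uminus_zero_free_intervals)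
    then show ?thesis
      using r(1) unfolding nn_integral_map_pmf by (intro exI[of _ "\<lambda>A. r (uminus ` A)"]) blast
  qed
qed

section \<open>Both lower bounds, with constants \<open>1 / 48\<close> and
  \<open>1 / 192\<close>\<close>

theorem theorem3:
  shows "(\<exists>c>0::real. \<exists>N::nat. \<forall>n\<ge>N. \<forall>D X.
            offset_distribution D \<longrightarrow> greedy_routing one_sided_step D n X \<longrightarrow>
            ennreal (c * ((ln (real n))\<^sup>2 / ln (ln (real n)))) / mean_links D
              \<le> expected_time D n X) \<and>
         (\<exists>c>0::real. \<exists>N::nat. \<forall>n\<ge>N. \<forall>D X.
            offset_distribution D \<longrightarrow> unimodal (incl_prob D) \<longrightarrow>
            (\<forall>\<delta>. incl_prob D \<delta> = incl_prob D (- \<delta>)) \<longrightarrow> pairwise_indep_offsets D \<longrightarrow>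
            greedy_routing two_sided_step D n X \<longrightarrow>
            ennreal (c * ((ln (real n))\<^sup>2 / ln (ln (real n)))) / (mean_links D)\<^sup>2
              \<le> expected_time D n X)"
proof -
  obtain N where N: "\<And>n. N \<le> n \<Longrightarrow> 1 \<le> ln (ln (real n))" "\<And>n. N \<le> n \<Longrightarrow> 1 \<le> ln (real n)"
    "\<And>n. N \<le> n \<Longrightarrow> threshold n < n"
    "\<And>n. N \<le> n \<Longrightarrow> (ln (real n))\<^sup>2 * (3 + ln (2 * (real (threshold n))\<^sup>2)) / 12
        \<le> ln (ln (real n)) * (ln (real n + 1) - ln (real (threshold n) + 1))\<^sup>2"
    using eventually_threshold unfolding eventually_sequentially by blast
  have L: "0 \<le> (ln (real n))\<^sup>2 / ln (ln (real n))" "(ln (real n))\<^sup>2 / ln (ln (real n)) \<le> (ln (real n))\<^sup>2"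
    "1 \<le> (ln (real n))\<^sup>2" if "N \<le> n" for n
    using N(1)[OF that] N(2)[OF that] by (auto simp: divide_le_eq mult_le_cancel_left1)
  have finite_mean: "\<exists>l. mean_links D = ennreal l \<and> 1 \<le> l \<and> (\<forall>S. finite S \<longrightarrow> (\<Sum>\<delta>\<in>S. incl_prob D \<delta>) \<le> l)"
    if D: "offset_distribution D" "mean_links D \<noteq> \<top>" for D
  proof -
    obtain l where l: "mean_links D = ennreal l" "0 \<le> l" using D(2) by (cases "mean_links D") auto
    have "1 \<le> l" using one_le_mean_links[OF D(1)] l by simp
    moreover have "(\<Sum>\<delta>\<in>S. incl_prob D \<delta>) \<le> l" if "finite S" for S
      using sum_incl_prob_le_mean_links[OF D(1) that] l by simp
    ultimately show ?thesis using l by blast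
  qed
  have nat_sum: "(\<Sum>\<delta>\<in>{1..m}. incl_prob D (int \<delta>)) \<le> l"
    if "\<forall>S. finite S \<longrightarrow> (\<Sum>\<delta>\<in>S. incl_prob D \<delta>) \<le> l" for D l m
  proof -
    have "(\<Sum>\<delta>\<in>{1..m}. incl_prob D (int \<delta>)) = (\<Sum>\<delta>\<in>int ` {1..m}. incl_prob D \<delta>)"
      by (subst sum.reindex) auto
    then show ?thesis using that by simp
  qed
  \<comment> \<open>With infinite mean the left side is 0. Otherwise the scale estimate with
    \<open>M = 1\<close> applies while \<open>l \<le> 4 * (ln n) ^ 2\<close>, and beyond that the
    left side is at most 1.\<close>
  have one: "ennreal (1 / 48 * ((ln (real n))\<^sup>2 / ln (ln (real n)))) / mean_links D \<le> expected_time D n X"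
    if n: "N \<le> n" and D: "offset_distribution D" and X: "greedy_routing one_sided_step D n X" for n D X
  proof (cases "mean_links D = \<top>")
    case False
    obtain l where l: "mean_links D = ennreal l" "1 \<le> l" "\<forall>S. finite S \<longrightarrow> (\<Sum>\<delta>\<in>S. incl_prob D \<delta>) \<le> l"
      using finite_mean[OF D False] by blast
    define Q where "Q = (ln (real n))\<^sup>2 / ln (ln (real n))"
    have Q: "0 \<le> Q" using L(1)[OF n] by (simp add: Q_def)
    have eq: "ennreal (1 / 48 * Q) / mean_links D = ennreal (Q / (48 * (1 * l)))"
      using Q l by (simp add: divide_ennreal)
    have "ennreal (Q / (48 * (1 * l))) \<le> expected_time D n X"
    proof (cases "l \<le> 4 * (ln (real n))\<^sup>2")
      case True
      show ?thesis
        unfolding Q_def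
      proof (rule expected_time_ge_scale[OF N(1)[OF n] N(2)[OF n] N(3)[OF n] N(4)[OF n], where \<F> = "(\<lambda>k. {1..int k}) ` {..n}"])
        show "0 \<le> incl_prob D (int \<delta>)" for \<delta> by (rule incl_prob_nonneg)
        show "(\<Sum>\<delta>\<in>{1..m}. incl_prob D (int \<delta>)) \<le> l" for m using l(3) by (rule nat_sum)
        show "\<exists>r :: int set \<Rightarrow> nat. (\<integral>\<^sup>+A. of_nat (r A) \<partial>measure_pmf D)
            \<le> ennreal (1 * (\<Sum>\<delta> | card I < threshold n * \<delta> \<and> \<delta> \<le> 2 * card I. incl_prob D (int \<delta>))) \<and>
            (\<forall>A\<in>set_pmf D. splits (threshold n) (r A) (det_step one_sided_step A) ((\<lambda>k. {1..int k}) ` {..n}) I)"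
          if I: "I \<in> (\<lambda>k. {1..int k}) ` {..n}" "threshold n < card I" for I
        proof -
          obtain k where k: "I = {1..int k}" "k \<le> n" using I(1) by blast
          let ?W = "{\<delta>. k < threshold n * \<delta> \<and> \<delta> \<le> 2 * k}"
          have "finite ?W" by (rule finite_subset[of _ "{..2 * k}"]) auto
          then have "(\<integral>\<^sup>+A. of_nat (card (A \<inter> int ` ?W)) \<partial>measure_pmf D) = ennreal (\<Sum>\<delta>\<in>?W. incl_prob D (int \<delta>))"
            by (subst sum_incl_prob[symmetric]) (auto simp: sum.reindex)
          moreover have "splits (threshold n) (card (A \<inter> int ` ?W)) (det_step one_sided_step A)
              ((\<lambda>k. {1..int k}) ` {..n}) {1..int k}" if "A \<in> set_pmf D" for A
            using D that I(2) k by (intro splits_one_sided) (auto simp: offset_distribution_def)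
          ultimately show ?thesis
            unfolding k(1) by (intro exI[of _ "\<lambda>A. card (A \<inter> int ` ?W)"]) auto
        qed
      qed (use True l(2) X in auto)
    next
      case False
      have "Q \<le> l" using L(2)[OF n] L(3)[OF n] False by (simp add: Q_def)
      then have "ennreal (Q / (48 * (1 * l))) \<le> 1" using l(2) by (simp add: divide_le_eq)
      also have "1 \<le> expected_time D n X"
        using expected_time_ge_1[OF X] N(3)[OF n] by simp
      finally show ?thesis .
    qed
    then show ?thesis using eq by (simp add: Q_def)
  qed simp
  \<comment> \<open>Here \<open>M = 4 * l\<close>, so \<open>48 * (M * l)\<close> is
    \<open>192 * l * l\<close>, and the condition \<open>M * l \<le> 4 * (ln n) ^ 2\<close> becomes
    the case distinction on \<open>l * l \<le> (ln n) ^ 2\<close>.\<close>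
  have two: "ennreal (1 / 192 * ((ln (real n))\<^sup>2 / ln (ln (real n)))) / (mean_links D)\<^sup>2 \<le> expected_time D n X"
    if n: "N \<le> n" and D: "offset_distribution D" and uni: "unimodal (incl_prob D)"
      and sym: "\<forall>\<delta>. incl_prob D \<delta> = incl_prob D (- \<delta>)" and indep: "pairwise_indep_offsets D"
      and X: "greedy_routing two_sided_step D n X" for n D X
  proof (cases "mean_links D = \<top>")
    case False
    obtain l where l: "mean_links D = ennreal l" "1 \<le> l" "\<forall>S. finite S \<longrightarrow> (\<Sum>\<delta>\<in>S. incl_prob D \<delta>) \<le> l"
      using finite_mean[OF D False] by blast
    define Q where "Q = (ln (real n))\<^sup>2 / ln (ln (real n))"
    have Q: "0 \<le> Q" using L(1)[OF n] by (simp add: Q_def)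
    have l2: "1 \<le> l * l" using mult_mono[OF l(2) l(2)] l(2) by simp
    have eq: "ennreal (1 / 192 * Q) / (mean_links D)\<^sup>2 = ennreal (Q / (48 * (4 * l * l)))"
      using Q l l2 by (simp add: divide_ennreal power2_eq_square ennreal_mult[symmetric] mult_ac)
    have "ennreal (Q / (48 * (4 * l * l))) \<le> expected_time D n X"
    proof (cases "l * l \<le> (ln (real n))\<^sup>2")
      case True
      show ?thesis
        unfolding Q_def
      proof (rule expected_time_ge_scale[OF N(1)[OF n] N(2)[OF n] N(3)[OF n] N(4)[OF n], where \<F> = "zero_free_intervals n"])
        show "0 \<le> incl_prob D (int \<delta>)" for \<delta> by (rule incl_prob_nonneg)
        show "(\<Sum>\<delta>\<in>{1..m}. incl_prob D (int \<delta>)) \<le> l" for m using l(3) by (rule nat_sum)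
        have "0 < threshold n"
          using N(2)[OF n] by (simp add: threshold_def)
        then show "\<exists>r :: int set \<Rightarrow> nat. (\<integral>\<^sup>+A. of_nat (r A) \<partial>measure_pmf D)
            \<le> ennreal (4 * l * (\<Sum>\<delta> | card I < threshold n * \<delta> \<and> \<delta> \<le> 2 * card I. incl_prob D (int \<delta>))) \<and>
            (\<forall>A\<in>set_pmf D. splits (threshold n) (r A) (det_step two_sided_step A) (zero_free_intervals n) I)"
          if I: "I \<in> zero_free_intervals n" "threshold n < card I" for I
          using splits_two_sided[OF D uni _ indep _ l(2) I(1) _ I(2)] sym l(3) by blast
        show "{1..int n} \<in> zero_free_intervals n" by (auto simp: zero_free_intervals_def)
      qed (use True l(2) l2 X in \<open>auto simp: zero_free_intervals_def\<close>)
    next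
      case False
      have "Q \<le> l * l" using L(2)[OF n] False by (simp add: Q_def)
      then have "ennreal (Q / (48 * (4 * l * l))) \<le> 1" using l2 by (simp add: divide_le_eq)
      also have "1 \<le> expected_time D n X"
        using expected_time_ge_1[OF X] N(3)[OF n] by simp
      finally show ?thesis .
    qed
    then show ?thesis using eq by (simp add: Q_def)
  qed (simp add: ennreal_top_mult power2_eq_square)
  show ?thesis
  proof (rule conjI)
    show "\<exists>c>0::real. \<exists>N::nat. \<forall>n\<ge>N. \<forall>D X.
            offset_distribution D \<longrightarrow> greedy_routing one_sided_step D n X \<longrightarrow>
            ennreal (c * ((ln (real n))\<^sup>2 / ln (ln (real n)))) / mean_links D
              \<le> expected_time D n X"
      using one by (intro exI[of _ "1 / 48"] conjI exI[of _ N]) auto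
    show "\<exists>c>0::real. \<exists>N::nat. \<forall>n\<ge>N. \<forall>D X.
            offset_distribution D \<longrightarrow> unimodal (incl_prob D) \<longrightarrow>
            (\<forall>\<delta>. incl_prob D \<delta> = incl_prob D (- \<delta>)) \<longrightarrow> pairwise_indep_offsets D \<longrightarrow>
            greedy_routing two_sided_step D n X \<longrightarrow>
            ennreal (c * ((ln (real n))\<^sup>2 / ln (ln (real n)))) / (mean_links D)\<^sup>2
              \<le> expected_time D n X"
      using two by (intro exI[of _ "1 / 192"] conjI exI[of _ N]) auto
  qed
qed

end
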